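(* Let $\Omega_{\alpha,\beta}$ be a well for the profile $c$, with associated constant $c_1$. Let $\lambda$ be an eigenvalue of $A_k$ (hence of $A$) such that $$\xi^2=\xi^2_{\lambda,k}:=2\Big(\mu_k^2-\frac{\lambda}{c_1}\Big)>0 \qquad(\xi>0),$$ and let $v_\lambda(x',y)=\phi_k(x')u_{\lambda,k}(y)$. Let $\overline{\Omega_{a,b}}\subset\overline{\Omega}\setminus\overline{\Omega_{\alpha,\beta}}$ and let $\mathrm{d}$ be the distance between $\overline{\Omega_{a,b}}$ and $\Omega_{\alpha,\beta}$. Then for any $0<t<1$, $$\int_{\Omega_{a,b}}v_\lambda^2(x)\,dx\le \sup_{y\in(\alpha,\beta)}\left|\frac{c_1-c(y)}{c_1c(y)}\right|\ \frac{\lambda}{\xi^3}\ \frac{e^{-\xi(1-t)\mathrm{d}}}{(1-t)\mathrm{d}}\int_{\Omega_{\alpha,\beta}}v_\lambda^2(x)\,dx .$$ Consequently, for fixed $\varepsilon>0$, if one considers the pairs $(k,\lambda)$, $\lambda$ an eigenvalue of $A_k$, with $$c_m\mu_k^2\le\lambda\le(c_1-\varepsilon)\mu_k^2,$$ and the eigenfunctions are normalized by $\int_\Omega|v_\lambda(x)|^2\tilde c(x)^{-1}dx=1$, then $$\lim_{\lambda\to\infty}\int_{\Omega_{a,b}}|v_\lambda(x)|^2\,dx=0$$ (the limit being taken along such pairs).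
   Context: Let $d\ge 1$, let $\Omega'\subset\mathbb{R}^d$ be an open bounded smooth domain, $H>0$, $\Omega=\Omega'\times(0,H)$ with points $x=(x',y)$, and $\Omega_{a,b}=\Omega'\times(a,b)$ for $0\le a<b\le H$. Let $(\mu_k^2,\phi_k)_{k\ge1}$, $\mu_k>0$, be the eigenvalues (nondecreasing, counted with multiplicity) and corresponding orthonormal eigenfunctions of $-\Delta_{x'}$ in $L^2(\Omega')$ with domain $H^2(\Omega')\cap H^1_0(\Omega')$. Let $c\in L^\infty(0,H)$ with $0<c_m=\operatorname{ess\,inf}c<c_M=\operatorname{ess\,sup}c$, and $\tilde c(x',y)=c(y)$. $A=-\tilde c\,\Delta$ acts in $L^2(\Omega;\tilde c^{-1}dx)$ with domain $H^2(\Omega)\cap H^1_0(\Omega)$; $A_k=c(y)\big(\mu_k^2-\frac{d^2}{dy^2}\big)$ acts in $L^2((0,H),c(y)^{-1}dy)$ with domain $H^2(0,H)\cap H^1_0(0,H)$. The eigenvalues of each $A_k$ are simple; for an eigenvalue $\lambda$ of $A_k$, $u_{\lambda,k}$ is the real eigenfunction of $A_k$ normalized in $L^2((0,H),c^{-1}dy)$. The layer $\Omega_{\alpha,\beta}$ is a well for the profile $c$ (with constant $c_1$) if $c_1>c_m$ and $c(y)\ge c_1$ for a.e. $y\in(0,H)\setminus(\alpha,\beta)$. Suprema of $L^\infty$ functions are essential suprema. *)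

theory Defs
  imports "HOL-Analysis.Analysis" "HOL-Probability.Essential_Supremum"
begin

text \<open>Function spaces on a set \<open>S\<close> consist of everywhere defined real functions, considered only on
  \<open>S\<close> and up to null sets of Lebesgue measure.\<close>

subsection \<open>Smoothness\<close>

primrec Ck :: "nat \<Rightarrow> ('a::euclidean_space \<Rightarrow> real) \<Rightarrow> bool" where
  "Ck 0 f \<longleftrightarrow> continuous_on UNIV f"
| "Ck (Suc n) f \<longleftrightarrow>
     (\<forall>x. f differentiable (at x)) \<and> (\<forall>v. Ck n (\<lambda>x. frechet_derivative f (at x) v))"

definition smooth :: "('a::euclidean_space \<Rightarrow> real) \<Rightarrow> bool" where
  "smooth f \<longleftrightarrow> (\<forall>n. Ck n f)"

definition test_functions :: "('a::euclidean_space) set \<Rightarrow> ('a \<Rightarrow> real) set" where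
  "test_functions S =
     {\<psi>. smooth \<psi> \<and> compact (closure {x. \<psi> x \<noteq> 0}) \<and> closure {x. \<psi> x \<noteq> 0} \<subseteq> S}"

text \<open>Near each boundary point, \<open>S\<close> is the strict epigraph of a smooth function \<open>\<gamma>\<close> of the
  coordinates orthogonal to a unit vector \<open>\<nu>\<close>; \<open>x - (x \<bullet> \<nu>) *\<^sub>R \<nu>\<close> is the projection of \<open>x\<close> to
  the hyperplane orthogonal to \<open>\<nu>\<close>, so only the values of \<open>\<gamma>\<close> on this hyperplane are used.\<close>

definition smooth_boundary :: "('a::euclidean_space) set \<Rightarrow> bool" where
  "smooth_boundary S \<longleftrightarrow>
     (\<forall>p\<in>frontier S. \<exists>r>0. \<exists>\<nu> \<gamma>. norm \<nu> = 1 \<and> smooth \<gamma> \<and>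
        S \<inter> ball p r = {x \<in> ball p r. x \<bullet> \<nu> > \<gamma> (x - (x \<bullet> \<nu>) *\<^sub>R \<nu>)})"

definition bounded_smooth_domain :: "('a::euclidean_space) set \<Rightarrow> bool" where
  "bounded_smooth_domain S \<longleftrightarrow>
     open S \<and> connected S \<and> S \<noteq> {} \<and> bounded S \<and> smooth_boundary S"

subsection \<open>Lebesgue spaces\<close>

text \<open>\<open>L2w S w\<close> is \<open>L\<^sup>2(S; w dx)\<close>.\<close>

definition L2w :: "('a::euclidean_space) set \<Rightarrow> ('a \<Rightarrow> real) \<Rightarrow> ('a \<Rightarrow> real) set" where
  "L2w S w = {f. f \<in> borel_measurable (lebesgue_on S) \<and>
                 integrable (lebesgue_on S) (\<lambda>x. (f x)\<^sup>2 * w x)}"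

abbreviation L2 :: "('a::euclidean_space) set \<Rightarrow> ('a \<Rightarrow> real) set" where
  "L2 S \<equiv> L2w S (\<lambda>_. 1)"

definition ess_sup :: "('a::euclidean_space) set \<Rightarrow> ('a \<Rightarrow> real) \<Rightarrow> real" where
  "ess_sup S f = real_of_ereal (esssup (lebesgue_on S) (\<lambda>x. ereal (f x)))"

definition ess_inf :: "('a::euclidean_space) set \<Rightarrow> ('a \<Rightarrow> real) \<Rightarrow> real" where
  "ess_inf S f = - ess_sup S (\<lambda>x. - f x)"

definition Linf :: "('a::euclidean_space) set \<Rightarrow> ('a \<Rightarrow> real) set" where
  "Linf S = {f. f \<in> borel_measurable (lebesgue_on S) \<and>
                esssup (lebesgue_on S) (\<lambda>x. ereal \<bar>f x\<bar>) < \<infinity>}"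

subsection \<open>Weak derivatives and Sobolev spaces\<close>

text \<open>\<open>g\<close> is the weak derivative of \<open>f\<close> on \<open>S\<close> in direction \<open>v\<close>, both being in \<open>L\<^sup>2(S)\<close>.\<close>

definition weak_deriv ::
  "('a::euclidean_space) set \<Rightarrow> 'a \<Rightarrow> ('a \<Rightarrow> real) \<Rightarrow> ('a \<Rightarrow> real) \<Rightarrow> bool" where
  "weak_deriv S v f g \<longleftrightarrow> f \<in> L2 S \<and> g \<in> L2 S \<and>
     (\<forall>\<psi>\<in>test_functions S.
        (\<integral>x. f x * frechet_derivative \<psi> (at x) v \<partial>lebesgue_on S)
        = - (\<integral>x. g x * \<psi> x \<partial>lebesgue_on S))"

definition H1 :: "('a::euclidean_space) set \<Rightarrow> ('a \<Rightarrow> real) set" where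
  "H1 S = {f \<in> L2 S. \<forall>b\<in>Basis. \<exists>g. weak_deriv S b f g}"

definition H2 :: "('a::euclidean_space) set \<Rightarrow> ('a \<Rightarrow> real) set" where
  "H2 S = {f \<in> H1 S. \<forall>b\<in>Basis. \<exists>g\<in>H1 S. weak_deriv S b f g}"

text \<open>The closure of the test functions in the norm of \<open>H\<^sup>1(S)\<close>.\<close>

definition H10 :: "('a::euclidean_space) set \<Rightarrow> ('a \<Rightarrow> real) set" where
  "H10 S = {f \<in> H1 S. \<exists>\<psi> :: nat \<Rightarrow> 'a \<Rightarrow> real.
     (\<forall>n. \<psi> n \<in> test_functions S) \<and>
     (\<lambda>n. \<integral>x. (f x - \<psi> n x)\<^sup>2 \<partial>lebesgue_on S) \<longlonglongrightarrow> 0 \<and>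
     (\<forall>b\<in>Basis. \<exists>g. weak_deriv S b f g \<and>
        (\<lambda>n. \<integral>x. (g x - frechet_derivative (\<psi> n) (at x) b)\<^sup>2 \<partial>lebesgue_on S) \<longlonglongrightarrow> 0)}"

definition weak_laplacian ::
  "('a::euclidean_space) set \<Rightarrow> ('a \<Rightarrow> real) \<Rightarrow> ('a \<Rightarrow> real) \<Rightarrow> bool" where
  "weak_laplacian S f l \<longleftrightarrow> (\<exists>D E.
     (\<forall>b\<in>Basis. weak_deriv S b f (D b) \<and> weak_deriv S b (D b) (E b)) \<and>
     (AE x in lebesgue_on S. l x = (\<Sum>b\<in>Basis. E b x)))"

subsection \<open>The operators, given by their graphs\<close>

text \<open>The operator \<open>- c \<Delta>\<close> in \<open>L\<^sup>2(S; c\<inverse> dx)\<close> with domain \<open>H\<^sup>2(S) \<inter> H\<^sup>1\<^sub>0(S)\<close>. For \<open>c = 1\<close> this is the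
  Dirichlet Laplacian.\<close>

definition op_A ::
  "('a::euclidean_space) set \<Rightarrow> ('a \<Rightarrow> real) \<Rightarrow> (('a \<Rightarrow> real) \<times> ('a \<Rightarrow> real)) set" where
  "op_A S c = {(f, g). f \<in> H2 S \<inter> H10 S \<and> f \<in> L2w S (\<lambda>x. 1 / c x) \<and> g \<in> L2w S (\<lambda>x. 1 / c x) \<and>
     (\<exists>l. weak_laplacian S f l \<and> (AE x in lebesgue_on S. g x = - c x * l x))}"

text \<open>The operator \<open>c(y) (\<mu>\<^sup>2 - d\<^sup>2/dy\<^sup>2)\<close> in \<open>L\<^sup>2((0,H), c\<inverse> dy)\<close> with domain \<open>H\<^sup>2(0,H) \<inter> H\<^sup>1\<^sub>0(0,H)\<close>.\<close>

definition op_Ak ::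
  "real \<Rightarrow> (real \<Rightarrow> real) \<Rightarrow> real \<Rightarrow> ((real \<Rightarrow> real) \<times> (real \<Rightarrow> real)) set" where
  "op_Ak H c \<mu> = {(f, g). f \<in> H2 {0<..<H} \<inter> H10 {0<..<H} \<and>
     f \<in> L2w {0<..<H} (\<lambda>y. 1 / c y) \<and> g \<in> L2w {0<..<H} (\<lambda>y. 1 / c y) \<and>
     (\<exists>f' f''. weak_deriv {0<..<H} 1 f f' \<and> weak_deriv {0<..<H} 1 f' f'' \<and>
        (AE y in lebesgue_on {0<..<H}. g y = c y * (\<mu>\<^sup>2 * f y - f'' y)))}"

definition eigenfunction ::
  "('a::euclidean_space) set \<Rightarrow> (('a \<Rightarrow> real) \<times> ('a \<Rightarrow> real)) set \<Rightarrow> real \<Rightarrow> ('a \<Rightarrow> real) \<Rightarrow> bool" where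
  "eigenfunction S T lam u \<longleftrightarrow>
     (u, \<lambda>x. lam * u x) \<in> T \<and> \<not> (AE x in lebesgue_on S. u x = 0)"

definition eigenvalue ::
  "('a::euclidean_space) set \<Rightarrow> (('a \<Rightarrow> real) \<times> ('a \<Rightarrow> real)) set \<Rightarrow> real \<Rightarrow> bool" where
  "eigenvalue S T lam \<longleftrightarrow> (\<exists>u. eigenfunction S T lam u)"

text \<open>\<open>(\<mu>\<^sub>k\<^sup>2, \<phi>\<^sub>k)\<close>, \<open>k \<ge> 1\<close>, enumerates the eigenvalues of the Dirichlet Laplacian. The last condition
  says that each eigenspace is spanned by the \<open>\<phi>\<^sub>k\<close> with this eigenvalue, hence that every eigenvalue
  occurs, and as often as its multiplicity.\<close>

definition dirichlet_eigensystem ::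
  "('a::euclidean_space) set \<Rightarrow> (nat \<Rightarrow> real) \<Rightarrow> (nat \<Rightarrow> 'a \<Rightarrow> real) \<Rightarrow> bool" where
  "dirichlet_eigensystem S \<mu> \<phi> \<longleftrightarrow>
     (\<forall>k\<ge>1. \<mu> k > 0 \<and> eigenfunction S (op_A S (\<lambda>_. 1)) ((\<mu> k)\<^sup>2) (\<phi> k)) \<and>
     (\<forall>j\<ge>1. \<forall>k\<ge>j. (\<mu> j)\<^sup>2 \<le> (\<mu> k)\<^sup>2) \<and>
     (\<forall>j\<ge>1. \<forall>k\<ge>1. (\<integral>x. \<phi> j x * \<phi> k x \<partial>lebesgue_on S) = (if j = k then 1 else 0)) \<and>
     (\<forall>\<Lambda> \<psi>. eigenfunction S (op_A S (\<lambda>_. 1)) \<Lambda> \<psi> \<longrightarrow>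
        (\<exists>K a. finite K \<and> K \<subseteq> {k. k \<ge> 1 \<and> (\<mu> k)\<^sup>2 = \<Lambda>} \<and>
           (AE x in lebesgue_on S. \<psi> x = (\<Sum>k\<in>K. a k * \<phi> k x))))"

subsection \<open>Layers and wells\<close>

definition layer :: "'a set \<Rightarrow> real \<Rightarrow> real \<Rightarrow> ('a \<times> real) set" where
  "layer \<Omega>' a b = \<Omega>' \<times> {a<..<b}"

text \<open>Whether \<open>\<Omega>' \<times> (\<alpha>,\<beta>)\<close> is a well depends on \<open>(\<alpha>,\<beta>)\<close> only.\<close>

definition is_well :: "real \<Rightarrow> (real \<Rightarrow> real) \<Rightarrow> real \<Rightarrow> real \<Rightarrow> real \<Rightarrow> bool" where
  "is_well H c \<alpha> \<beta> c1 \<longleftrightarrow> c1 > ess_inf {0<..<H} c \<and>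
     (AE y in lebesgue_on ({0<..<H} - {\<alpha><..<\<beta>}). c y \<ge> c1)"

definition tensor :: "('a \<Rightarrow> real) \<Rightarrow> (real \<Rightarrow> real) \<Rightarrow> 'a \<times> real \<Rightarrow> real" where
  "tensor \<phi> u = (\<lambda>(x', y). \<phi> x' * u y)"

text \<open>The pairs \<open>(k, lam)\<close>, \<open>lam\<close> an eigenvalue of \<open>A\<^sub>k\<close>, with \<open>c\<^sub>m \<mu>\<^sub>k\<^sup>2 \<le> lam \<le> (c\<^sub>1 - \<epsilon>) \<mu>\<^sub>k\<^sup>2\<close>.\<close>

definition guided_pairs ::
  "real \<Rightarrow> (real \<Rightarrow> real) \<Rightarrow> (nat \<Rightarrow> real) \<Rightarrow> real \<Rightarrow> real \<Rightarrow> (nat \<times> real) set" where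
  "guided_pairs H c \<mu> c1 \<epsilon> = {(k, lam). k \<ge> 1 \<and> eigenvalue {0<..<H} (op_Ak H c (\<mu> k)) lam \<and>
     ess_inf {0<..<H} c * (\<mu> k)\<^sup>2 \<le> lam \<and> lam \<le> (c1 - \<epsilon>) * (\<mu> k)\<^sup>2}"

end

theory Submission
  imports Defs
begin

text \<open>
  Since \<open>\<phi>\<^sub>k\<close> is normalised, the integral of \<open>v\<^sup>2\<close> over a layer \<open>\<Omega>' \<times> (a,b)\<close> is \<open>\<integral>\<^sub>a\<^sup>b u\<^sup>2\<close>, so the
  estimate is one-dimensional. With \<open>p\<^sup>2 = \<mu>\<^sup>2 - \<lambda>/c\<^sub>1 = \<xi>\<^sup>2/2\<close> the eigenvalue equation reads
  \<open>- u'' + p\<^sup>2 u = q u\<close> with \<open>q = \<lambda>(1/c - 1/c\<^sub>1)\<close>; here \<open>q \<le> 0\<close> off the well and \<open>q \<le> \<lambda>K\<close> in the well,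
  \<open>K\<close> being the supremum in the statement. Testing with \<open>\<eta>u\<close> gives the weighted energy identity

  \<open>\<integral> \<eta>(u'\<^sup>2 + p\<^sup>2u\<^sup>2) + \<eta>' u u' = \<integral> \<eta> q u\<^sup>2\<close>, and trivially \<open>\<integral> u u' = 0\<close>.

  The weight is the heart of the proof. Let \<open>z\<close> be the distance to the well, cut off at its value \<open>d\<close>
  on \<open>(a,b)\<close>, on the side of the well where \<open>(a,b)\<close> lies, and \<open>0\<close> on the other side. The weight
  \<open>\<eta> = 2 e\<^bsup>2pz\<^esup> - 1\<close> solves \<open>\<eta>' = \<plusminus>2p(\<eta> + 1)\<close> in the gap, so that after
  subtracting \<open>\<plusminus>2p \<integral> u u' = 0\<close> the integrand on the left is the nonnegative form
  \<open>\<eta>(u'\<^sup>2 + p\<^sup>2u\<^sup>2) \<plusminus> 2p\<eta> u u'\<close> in the gap, \<open>u'\<^sup>2 + p\<^sup>2u\<^sup>2 \<minusplus> 2p u u' \<ge> 0\<close> where \<open>\<eta> = 1\<close>, and at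
  least \<open>p\<^sup>2(N - 1/N) u\<^sup>2\<close> on \<open>(a,b)\<close>, where \<open>\<eta> = N = 2e\<^bsup>2pd\<^esup> - 1\<close>. Hence
  \<open>p\<^sup>2(N - 1/N) \<integral>\<^sub>a\<^sup>b u\<^sup>2 \<le> \<lambda>K \<integral>\<^sub>\<alpha>\<^sup>\<beta> u\<^sup>2\<close> (lemma \<open>decay_from_energy_identity\<close>). Because
  \<open>2p = \<surd>2 \<xi>\<close> exceeds \<open>\<xi>\<close>, the elementary inequality \<open>x e\<^sup>x \<le> e\<^bsup>\<surd>2 x\<^esup> - 1\<close> with \<open>x = \<xi>d\<close>
  (lemma \<open>exp_weight_bound\<close>) turns this into the value of the claimed bound at \<open>t = 0\<close>, and that
  bound increases with \<open>t\<close>.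

  Only test functions may be inserted into a weak derivative, so the energy identity first comes for
  smooth \<open>\<eta>\<close>: then \<open>\<eta>\<psi>\<^sub>n\<close> is a test function for test functions \<open>\<psi>\<^sub>n \<rightarrow> u\<close> in \<open>H\<^sup>1\<close>
  (\<open>energy_identity_smooth\<close>). It passes to \<open>C\<^sup>1\<close> weights by polynomial approximation of \<open>\<eta>'\<close>, and to
  the weight above, which has two kinks, by smoothing absolute values.

  That \<open>v = \<phi>\<^sub>k \<otimes> u\<close> is an eigenfunction of \<open>A\<close> is separation of variables: weak derivatives of tensor
  products are computed by Fubini's theorem on slices, and tensor products of test functions
  approximate \<open>v\<close> in \<open>H\<^sup>1\<^sub>0\<close>. For the limit, \<open>\<lambda> \<le> (c\<^sub>1 - \<epsilon>)\<mu>\<^sup>2\<close> gives \<open>\<xi>\<^sup>2 \<ge> \<delta>\<lambda>\<close> with a fixed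
  \<open>\<delta> > 0\<close>, and the estimate is \<open>O(\<lambda>\<^bsup>-1/2\<^esup>)\<close>.
\<close>

section \<open>Smooth functions and test functions\<close>

lemma Ck_Suc_imp_Ck: "Ck (Suc n) f \<Longrightarrow> Ck n f"
proof (induction n arbitrary: f)
  case 0
  then have "f differentiable (at x)" for x by simp
  then have "isCont f x" for x by (rule differentiable_imp_continuous_within)
  then show ?case by (simp add: continuous_on_eq_continuous_at)
next
  case (Suc n)
  then show ?case
    using Ck.simps(2)[of "Suc n" f] Ck.simps(2)[of n f] by blast
qed

lemma smooth_differentiable:
  assumes "smooth f" shows "f differentiable (at x)"
proof -
  have "Ck (Suc 0) f" using assms by (simp only: smooth_def)
  then show ?thesis by simp
qed

lemma smooth_continuous_on:
  assumes "smooth f" shows "continuous_on S f"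
proof -
  have "Ck 0 f" using assms by (simp only: smooth_def)
  then show ?thesis using continuous_on_subset by auto
qed

lemma smooth_frechet_derivative:
  assumes "smooth f" shows "smooth (\<lambda>x. frechet_derivative f (at x) v)"
  unfolding smooth_def
proof
  fix n
  have "Ck (Suc n) f" using assms by (simp only: smooth_def)
  then show "Ck n (\<lambda>x. frechet_derivative f (at x) v)" by simp
qed

lemma smooth_has_derivative:
  "smooth f \<Longrightarrow> (f has_derivative frechet_derivative f (at x)) (at x)"
  by (simp add: smooth_differentiable frechet_derivative_works[symmetric])

lemma smooth_frechet_derivative_0: "smooth f \<Longrightarrow> frechet_derivative f (at x) 0 = 0"
  by (rule linear_0[OF has_derivative_linear[OF smooth_has_derivative]])

lemma Ck_SucI:
  assumes "\<And>x. (f has_derivative D x) (at x)" and "\<And>v. Ck n (\<lambda>x. D x v)"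
  shows "Ck (Suc n) f"
proof -
  have "frechet_derivative f (at x) = D x" for x
    using assms(1) by (rule frechet_derivative_at[symmetric])
  then show ?thesis
    using assms by (auto simp: differentiable_def)
qed

lemma Ck_SucE:
  assumes "Ck (Suc n) f"
  obtains D where "\<And>x. (f has_derivative D x) (at x)" "\<And>v. Ck n (\<lambda>x. D x v)"
  using assms that[of "\<lambda>x. frechet_derivative f (at x)"]
  by (auto simp: frechet_derivative_works)

lemma Ck_const: "Ck n (\<lambda>x. k)"
proof (induction n arbitrary: k)
  case (Suc n)
  show ?case by (rule Ck_SucI[where D = "\<lambda>_ _. 0"]) (auto intro: Suc)
qed simp

lemma Ck_add: "Ck n f \<Longrightarrow> Ck n g \<Longrightarrow> Ck n (\<lambda>x. f x + g x)"
proof (induction n arbitrary: f g)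
  case 0
  then show ?case by (auto intro: continuous_on_add)
next
  case (Suc n)
  obtain D where D: "\<And>x. (f has_derivative D x) (at x)" "\<And>v. Ck n (\<lambda>x. D x v)"
    using Suc.prems(1) by (rule Ck_SucE) blast
  obtain E where E: "\<And>x. (g has_derivative E x) (at x)" "\<And>v. Ck n (\<lambda>x. E x v)"
    using Suc.prems(2) by (rule Ck_SucE) blast
  show ?case
    by (rule Ck_SucI[where D = "\<lambda>x v. D x v + E x v"])
       (auto intro!: D E Suc.IH has_derivative_add)
qed

lemma Ck_mult: "Ck n f \<Longrightarrow> Ck n g \<Longrightarrow> Ck n (\<lambda>x. f x * g x)"
proof (induction n arbitrary: f g)
  case 0
  then show ?case by (auto intro: continuous_on_mult)
next
  case (Suc n)
  obtain D where D: "\<And>x. (f has_derivative D x) (at x)" "\<And>v. Ck n (\<lambda>x. D x v)"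
    using Suc.prems(1) by (rule Ck_SucE) blast
  obtain E where E: "\<And>x. (g has_derivative E x) (at x)" "\<And>v. Ck n (\<lambda>x. E x v)"
    using Suc.prems(2) by (rule Ck_SucE) blast
  show ?case
    by (rule Ck_SucI[where D = "\<lambda>x v. f x * E x v + D x v * g x"])
       (intro D E Suc.IH has_derivative_mult Ck_add Suc.prems[THEN Ck_Suc_imp_Ck])+
qed

text \<open>Slices of a smooth function and pullbacks under a coordinate projection are both
  compositions with an affine map, which never leave the class.\<close>

lemma Ck_compose_affine:
  assumes "bounded_linear L"
  shows "Ck n f \<Longrightarrow> Ck n (\<lambda>x. f (L x + p))"
proof (induction n arbitrary: f)
  case 0
  then show ?case
    using continuous_on_compose2[of UNIV f UNIV "\<lambda>x. L x + p"] linear_continuous_on[OF assms, of UNIV]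
    by (simp add: continuous_on_add)
next
  case (Suc n)
  obtain D where D: "\<And>x. (f has_derivative D x) (at x)" "\<And>v. Ck n (\<lambda>x. D x v)"
    using Suc.prems by (rule Ck_SucE) blast
  have "((\<lambda>x. L x + p) has_derivative L) (at x)" for x
    using assms by (auto intro!: derivative_eq_intros bounded_linear_imp_has_derivative)
  then have "((\<lambda>x. f (L x + p)) has_derivative (\<lambda>v. D (L x + p) (L v))) (at x)" for x
    using has_derivative_compose D(1) by blast
  then show ?case
    by (rule Ck_SucI) (auto intro: Suc.IH D(2))
qed

lemma smooth_mult: "smooth f \<Longrightarrow> smooth g \<Longrightarrow> smooth (\<lambda>x. f x * g x)"
  by (simp add: smooth_def Ck_mult)

lemma smooth_compose_affine:
  "bounded_linear L \<Longrightarrow> smooth f \<Longrightarrow> smooth (\<lambda>x. f (L x + p))"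
  by (simp add: smooth_def Ck_compose_affine)

lemma smooth_compose_linear:
  "bounded_linear L \<Longrightarrow> smooth f \<Longrightarrow> smooth (\<lambda>x. f (L x))"
  using smooth_compose_affine[of L f 0] by simp

lemma Ck_real_polynomial_function:
  fixes P :: "real \<Rightarrow> real"
  shows "real_polynomial_function P \<Longrightarrow> Ck n P"
proof (induction n arbitrary: P)
  case 0
  then show ?case
    using continuous_on_polymonial_function[of P UNIV] by (simp add: real_polynomial_function_eq)
next
  case (Suc n)
  obtain P' where P': "real_polynomial_function P'" "\<And>x. (P has_real_derivative P' x) (at x)"
    using has_real_derivative_polynomial_function[OF Suc.prems] by blast
  show ?case
  proof (rule Ck_SucI)
    show "(P has_derivative (\<lambda>v. P' x * v)) (at x)" for x
      using P'(2)[of x] by (simp add: has_field_derivative_def)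
    show "Ck n (\<lambda>x. P' x * v)" for v
      by (intro Ck_mult Suc.IH P'(1) Ck_const)
  qed
qed

lemma smooth_real_polynomial_function:
  fixes P :: "real \<Rightarrow> real"
  shows "real_polynomial_function P \<Longrightarrow> smooth P"
  by (simp add: smooth_def Ck_real_polynomial_function)

lemma frechet_derivative_real:
  assumes "(f has_real_derivative D) (at x)"
  shows "frechet_derivative f (at x) v = D * v"
  using frechet_derivative_at[OF assms[unfolded has_field_derivative_def]]
  by (rule fun_cong[OF sym])

lemma test_functions_smooth: "\<psi> \<in> test_functions S \<Longrightarrow> smooth \<psi>"
  by (simp add: test_functions_def)

lemma test_functionsI:
  assumes "smooth \<psi>" "compact K" "K \<subseteq> S" "\<And>x. x \<notin> K \<Longrightarrow> \<psi> x = 0"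
  shows "\<psi> \<in> test_functions S"
proof -
  have "closure {x. \<psi> x \<noteq> 0} \<subseteq> K"
    using assms(2,4) by (intro closure_minimal compact_imp_closed) auto
  moreover from this have "compact (closure {x. \<psi> x \<noteq> 0})"
    using assms(2) by (metis closed_closure closed_Int_compact inf.absorb_iff1)
  ultimately show ?thesis
    using assms(1,3) unfolding test_functions_def by blast
qed

lemma test_functions_support:
  assumes "\<psi> \<in> test_functions S"
  shows "\<exists>K. compact K \<and> K \<subseteq> S \<and>
    (\<forall>x. x \<notin> K \<longrightarrow> \<psi> x = 0 \<and> (\<forall>v. frechet_derivative \<psi> (at x) v = 0))"
proof -
  define K where "K = closure {x. \<psi> x \<noteq> 0}"
  have K: "compact K" "K \<subseteq> S" using assms by (auto simp: test_functions_def K_def)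
  have 0: "\<psi> x = 0" if "x \<notin> K" for x
    using that closure_subset[of "{x. \<psi> x \<noteq> 0}"] by (auto simp: K_def)
  have "frechet_derivative \<psi> (at x) v = 0" if x: "x \<notin> K" for x v
  proof -
    have "((\<lambda>_. 0) has_derivative (\<lambda>_. 0)) (at x)" by simp
    then have "(\<psi> has_derivative (\<lambda>_. 0)) (at x)"
      by (rule has_derivative_transform_within_open[where s = "- K"])
        (use x 0 K(1) in \<open>auto simp: compact_imp_closed open_Compl\<close>)
    from frechet_derivative_at[OF this, symmetric] show ?thesis by simp
  qed
  with K 0 show ?thesis by blast
qed

lemma test_functions_frechet_derivative:
  assumes "\<psi> \<in> test_functions S"
  shows "(\<lambda>x. frechet_derivative \<psi> (at x) v) \<in> test_functions S"
proof -
  obtain K where "compact K" "K \<subseteq> S" "\<And>x. x \<notin> K \<Longrightarrow> frechet_derivative \<psi> (at x) v = 0"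
    using test_functions_support[OF assms] by blast
  then show ?thesis
    using smooth_frechet_derivative[OF test_functions_smooth[OF assms]]
    by (intro test_functionsI[of _ K]) auto
qed

lemma test_functions_mult:
  assumes "smooth \<eta>" "\<psi> \<in> test_functions S"
  shows "(\<lambda>x. \<eta> x * \<psi> x) \<in> test_functions S"
proof -
  obtain K where "compact K" "K \<subseteq> S" "\<And>x. x \<notin> K \<Longrightarrow> \<psi> x = 0"
    using test_functions_support[OF assms(2)] by blast
  then show ?thesis
    using smooth_mult[OF assms(1) test_functions_smooth[OF assms(2)]]
    by (intro test_functionsI[of _ K]) auto
qed

lemma test_functions_tensor:
  assumes "\<psi> \<in> test_functions S" "\<theta> \<in> test_functions T"
  shows "tensor \<psi> \<theta> \<in> test_functions (S \<times> T)"
proof -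
  obtain K where "compact K" "K \<subseteq> S" "\<And>x. x \<notin> K \<Longrightarrow> \<psi> x = 0"
    using test_functions_support[OF assms(1)] by blast
  moreover obtain L where "compact L" "L \<subseteq> T" "\<And>x. x \<notin> L \<Longrightarrow> \<theta> x = 0"
    using test_functions_support[OF assms(2)] by blast
  moreover have "smooth (\<lambda>z. \<psi> (fst z) * \<theta> (snd z))"
    by (rule smooth_mult[OF smooth_compose_linear[OF bounded_linear_fst]
          smooth_compose_linear[OF bounded_linear_snd]])
       (use assms test_functions_smooth in blast)+
  ultimately show ?thesis
    unfolding tensor_def case_prod_unfold
    by (intro test_functionsI[of _ "K \<times> L"]) (auto intro: compact_Times, metis+)
qed

lemma tensor_derivative:
  assumes "smooth \<psi>" "smooth \<theta>"
  shows "frechet_derivative (tensor \<psi> \<theta>) (at z) (v, w) =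
    tensor (\<lambda>x. frechet_derivative \<psi> (at x) v) \<theta> z + tensor \<psi> (\<lambda>y. frechet_derivative \<theta> (at y) w) z"
proof -
  have 1: "((\<lambda>z. \<psi> (fst z)) has_derivative (\<lambda>v. frechet_derivative \<psi> (at (fst z)) (fst v))) (at z)"
    by (rule has_derivative_compose[OF bounded_linear_imp_has_derivative[OF bounded_linear_fst]
          smooth_has_derivative[OF assms(1)]])
  have 2: "((\<lambda>z. \<theta> (snd z)) has_derivative (\<lambda>v. frechet_derivative \<theta> (at (snd z)) (snd v))) (at z)"
    by (rule has_derivative_compose[OF bounded_linear_imp_has_derivative[OF bounded_linear_snd]
          smooth_has_derivative[OF assms(2)]])
  show ?thesis
    using has_derivative_mult[OF 1 2]
    unfolding tensor_def case_prod_unfold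
    by (subst frechet_derivative_at[symmetric], assumption) simp
qed

lemma slice_derivative:
  assumes "smooth \<psi>" "bounded_linear L"
  shows "frechet_derivative (\<lambda>x. \<psi> (L x + p)) (at x) v = frechet_derivative \<psi> (at (L x + p)) (L v)"
proof -
  have "((\<lambda>x. L x + p) has_derivative L) (at x)" for x
    using assms by (auto intro!: derivative_eq_intros bounded_linear_imp_has_derivative)
  from frechet_derivative_at[OF has_derivative_compose[OF this smooth_has_derivative[OF assms(1)]]]
  show ?thesis by (rule fun_cong[OF sym])
qed

lemma test_functions_slice:
  assumes "\<psi> \<in> test_functions (S \<times> T)"
  shows "(\<lambda>x. \<psi> (x, y)) \<in> test_functions S"
    and "frechet_derivative (\<lambda>x. \<psi> (x, y)) (at x) v = frechet_derivative \<psi> (at (x, y)) (v, 0)"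
    and "(\<lambda>y. \<psi> (x, y)) \<in> test_functions T"
    and "frechet_derivative (\<lambda>y. \<psi> (x, y)) (at y) w = frechet_derivative \<psi> (at (x, y)) (0, w)"
proof -
  obtain K where K: "compact K" "K \<subseteq> S \<times> T" "\<And>z. z \<notin> K \<Longrightarrow> \<psi> z = 0"
    using test_functions_support[OF assms] by blast
  have bl: "bounded_linear (\<lambda>x. (x, 0))" "bounded_linear (\<lambda>y. (0, y))"
    by (auto intro!: bounded_linear_Pair bounded_linear_ident bounded_linear_zero)
  have s: "smooth \<psi>" using assms by (rule test_functions_smooth)
  have "compact (fst ` K)" "compact (snd ` K)"
    using K(1) by (auto intro!: compact_continuous_image continuous_intros)
  moreover have "smooth (\<lambda>x. \<psi> (x, y))" "smooth (\<lambda>y. \<psi> (x, y))"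
    using smooth_compose_affine[OF bl(1) s, of "(0, y)"]
      smooth_compose_affine[OF bl(2) s, of "(x, 0)"] by auto
  moreover have "fst ` K \<subseteq> S" "snd ` K \<subseteq> T" using K(2) by auto
  moreover have "\<psi> (x, y) = 0" if "x \<notin> fst ` K \<or> y \<notin> snd ` K" for x y
    using that K(3)[of "(x, y)"] by (metis fst_conv snd_conv image_eqI)
  ultimately show "(\<lambda>x. \<psi> (x, y)) \<in> test_functions S" "(\<lambda>y. \<psi> (x, y)) \<in> test_functions T"
    by (auto intro: test_functionsI)
  show "frechet_derivative (\<lambda>x. \<psi> (x, y)) (at x) v = frechet_derivative \<psi> (at (x, y)) (v, 0)"
    using slice_derivative[OF s bl(1), of "(0, y)" x v] by simp
  show "frechet_derivative (\<lambda>y. \<psi> (x, y)) (at y) w = frechet_derivative \<psi> (at (x, y)) (0, w)"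
    using slice_derivative[OF s bl(2), of "(x, 0)" y w] by simp
qed

section \<open>Lebesgue measure on a product set\<close>

lemma Times_null_sets_lborel:
  fixes A :: "'a::euclidean_space set" and B :: "'b::euclidean_space set"
  assumes "A \<in> null_sets lborel" "B \<in> null_sets lborel"
  shows "A \<times> UNIV \<union> UNIV \<times> B \<in> null_sets (lborel :: ('a \<times> 'b) measure)"
proof -
  have "A \<times> UNIV \<in> null_sets (lborel \<Otimes>\<^sub>M (lborel :: 'b measure))"
    using assms(1) by (rule lborel.times_in_null_sets1) simp
  moreover have "UNIV \<times> B \<in> null_sets ((lborel :: 'a measure) \<Otimes>\<^sub>M lborel)"
    using assms(2) by (intro lborel.times_in_null_sets2) simp
  ultimately show ?thesis by (simp only: lborel_prod null_sets.Un)
qed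

lemma lebesgue_Times:
  fixes A :: "'a::euclidean_space set" and B :: "'b::euclidean_space set"
  assumes A: "A \<in> sets lebesgue" and B: "B \<in> sets lebesgue"
  shows "A \<times> B \<in> sets lebesgue"
    and "emeasure lebesgue (A \<times> B) = emeasure lebesgue A * emeasure lebesgue B"
proof -
  define A0 where "A0 = main_part lborel A"
  define B0 where "B0 = main_part lborel B"
  obtain M where M: "M \<in> null_sets lborel" "null_part lborel A \<subseteq> M"
    using null_part[OF A] by blast
  obtain N where N: "N \<in> null_sets lborel" "null_part lborel B \<subseteq> N"
    using null_part[OF B] by blast
  have AB: "A = A0 \<union> null_part lborel A" "B = B0 \<union> null_part lborel B"
    using A B by (simp_all add: A0_def B0_def)
  have 0: "A0 \<in> sets lborel" "B0 \<in> sets lborel"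
    using A B by (auto simp only: A0_def B0_def intro: main_part_sets)
  have AB0: "A0 \<times> B0 \<in> sets lborel"
    using pair_measureI[OF 0] by (simp only: lborel_prod)
  have "(M \<times> UNIV \<union> UNIV \<times> N) \<in> null_sets lebesgue"
    by (intro null_sets_completionI Times_null_sets_lborel M N)
  then have W: "A \<times> B - A0 \<times> B0 \<in> null_sets lebesgue"
    by (rule null_sets_completion_subset[rotated]) (use AB M N in auto)
  have eq: "A \<times> B = A0 \<times> B0 \<union> (A \<times> B - A0 \<times> B0)" using AB by auto
  have AB0': "A0 \<times> B0 \<in> sets lebesgue" using AB0 by (rule sets_completionI_sets)
  show "A \<times> B \<in> sets lebesgue"
    using AB0' null_setsD2[OF W] by (subst eq) (rule sets.Un)
  have "emeasure lebesgue (A \<times> B) = emeasure lebesgue (A0 \<times> B0)"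
    by (subst eq) (rule emeasure_Un_null_set[OF AB0' W])
  also have "\<dots> = emeasure lborel (A0 \<times> B0)"
    using AB0 by simp
  also have "\<dots> = emeasure lborel A0 * emeasure lborel B0"
    using lborel.emeasure_pair_measure_Times[OF 0] by (simp only: lborel_prod)
  finally show "emeasure lebesgue (A \<times> B) = emeasure lebesgue A * emeasure lebesgue B"
    using A B by (simp add: A0_def B0_def)
qed

lemma sigma_finite_lebesgue_on:
  assumes "S \<in> sets lebesgue" shows "sigma_finite_measure (lebesgue_on S)"
proof -
  obtain C :: "'a set set" where C: "countable C" "C \<subseteq> sets lborel" "\<Union>C = UNIV"
      "\<forall>a\<in>C. emeasure lborel a \<noteq> \<infinity>"
    using lborel.sigma_finite_countable by auto
  have "sigma_finite_measure (lebesgue :: 'a measure)"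
  proof
    show "\<exists>A. countable A \<and> A \<subseteq> sets (lebesgue :: 'a measure) \<and> \<Union>A = space lebesgue \<and>
        (\<forall>a\<in>A. emeasure lebesgue a \<noteq> \<infinity>)"
      using C by (intro exI[of _ C]) auto
  qed
  then show ?thesis
    using assms by (rule sigma_finite_measure_restrict_space)
qed

locale lebesgue_product =
  fixes S :: "'a::euclidean_space set" and T :: "'b::euclidean_space set"
  assumes S[measurable]: "S \<in> sets lebesgue" and T[measurable]: "T \<in> sets lebesgue"
begin

sublocale pair_sigma_finite "lebesgue_on S" "lebesgue_on T"
  by (intro pair_sigma_finite.intro sigma_finite_lebesgue_on S T)

text \<open>Lebesgue measure on \<open>S \<times> T\<close> is the completion of the product of the Lebesgue measures on the
  factors. Regarding the identity as a measurable map onto the uncompleted product transports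
  Fubini's theorem to all functions that are measurable for the latter.\<close>

lemma measurable_to_pair:
  "(\<lambda>z. z) \<in> measurable (lebesgue_on (S \<times> T)) (lebesgue_on S \<Otimes>\<^sub>M lebesgue_on T)"
proof (rule measurableI)
  show "z \<in> space (lebesgue_on S \<Otimes>\<^sub>M lebesgue_on T)" if "z \<in> space (lebesgue_on (S \<times> T))" for z
    using that by (simp add: space_pair_measure)
  fix A assume "A \<in> sets (lebesgue_on S \<Otimes>\<^sub>M lebesgue_on T)"
  then have "A \<in> sigma_sets (S \<times> T) {a \<times> b |a b. a \<in> sets (lebesgue_on S) \<and> b \<in> sets (lebesgue_on T)}"
    by (simp add: sets_pair_measure)
  then have "A \<in> sets (lebesgue_on (S \<times> T))"
  proof induction
    case (Basic A)
    then obtain a b where "A = a \<times> b" "a \<in> sets lebesgue" "b \<in> sets lebesgue" "a \<subseteq> S" "b \<subseteq> T"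
      using S T by (auto simp: sets_restrict_space_iff)
    then show ?case
      using S T by (auto simp: sets_restrict_space_iff lebesgue_Times)
  next
    case (Compl A)
    then show ?case using sets.compl_sets[of A "lebesgue_on (S \<times> T)"] by simp
  qed auto
  then show "(\<lambda>z. z) -` A \<inter> space (lebesgue_on (S \<times> T)) \<in> sets (lebesgue_on (S \<times> T))"
    by (metis inf.absorb1 sets.sets_into_space vimage_ident)
qed

lemma distr_eq_pair:
  "distr (lebesgue_on (S \<times> T)) (lebesgue_on S \<Otimes>\<^sub>M lebesgue_on T) (\<lambda>z. z) =
    lebesgue_on S \<Otimes>\<^sub>M lebesgue_on T"
proof (rule pair_measure_eqI[symmetric])
  show "sigma_finite_measure (lebesgue_on S)" "sigma_finite_measure (lebesgue_on T)"
    by (intro sigma_finite_lebesgue_on S T)+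
  fix A B assume "A \<in> sets (lebesgue_on S)" "B \<in> sets (lebesgue_on T)"
  moreover from this have "A \<in> sets lebesgue" "B \<in> sets lebesgue" "A \<subseteq> S" "B \<subseteq> T"
    using S T by (auto simp: sets_restrict_space_iff)
  ultimately show "emeasure (lebesgue_on S) A * emeasure (lebesgue_on T) B =
      emeasure (distr (lebesgue_on (S \<times> T)) (lebesgue_on S \<Otimes>\<^sub>M lebesgue_on T) (\<lambda>z. z)) (A \<times> B)"
    using S T lebesgue_Times[of S T] lebesgue_Times[of A B]
    by (simp add: emeasure_distr measurable_to_pair emeasure_restrict_space Int_absorb2
        Sigma_mono del: emeasure_completion)
qed simp

lemma integrable_pair_iff:
  fixes f :: "'a \<times> 'b \<Rightarrow> real"
  assumes "f \<in> borel_measurable (lebesgue_on S \<Otimes>\<^sub>M lebesgue_on T)"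
  shows "integrable (lebesgue_on (S \<times> T)) f \<longleftrightarrow> integrable (lebesgue_on S \<Otimes>\<^sub>M lebesgue_on T) f"
  using integrable_distr_eq[OF measurable_to_pair assms] by (simp add: distr_eq_pair)

lemma integral_pair_eq:
  fixes f :: "'a \<times> 'b \<Rightarrow> real"
  assumes "f \<in> borel_measurable (lebesgue_on S \<Otimes>\<^sub>M lebesgue_on T)"
  shows "(\<integral>z. f z \<partial>lebesgue_on (S \<times> T)) = (\<integral>z. f z \<partial>(lebesgue_on S \<Otimes>\<^sub>M lebesgue_on T))"
  using integral_distr[OF measurable_to_pair assms] by (simp add: distr_eq_pair)

lemma measurable_pair_imp:
  "f \<in> measurable (lebesgue_on S \<Otimes>\<^sub>M lebesgue_on T) N \<Longrightarrow> f \<in> measurable (lebesgue_on (S \<times> T)) N"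
  using measurable_compose[OF measurable_to_pair] by blast

lemma AE_fst:
  assumes "AE x in lebesgue_on S. P x"
  shows "AE z in lebesgue_on (S \<times> T). P (fst z)"
proof -
  obtain N where N: "N \<in> null_sets (lebesgue_on S)" "\<And>x. x \<in> S \<Longrightarrow> \<not> P x \<Longrightarrow> x \<in> N"
    using AE_E3[OF assms] by (metis DiffI space_lebesgue_on)
  have "N \<times> T \<in> null_sets (lebesgue_on S \<Otimes>\<^sub>M lebesgue_on T)"
    using N(1) by (rule M2.times_in_null_sets1) simp
  then have "N \<times> T \<in> null_sets (distr (lebesgue_on (S \<times> T)) (lebesgue_on S \<Otimes>\<^sub>M lebesgue_on T) (\<lambda>z. z))"
    by (simp add: distr_eq_pair)
  then have "(\<lambda>z. z) -` (N \<times> T) \<inter> S \<times> T \<in> null_sets (lebesgue_on (S \<times> T))"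
    using null_sets_distr_iff[OF measurable_to_pair] by simp
  then show ?thesis
  proof (rule AE_I')
    show "{z \<in> space (lebesgue_on (S \<times> T)). \<not> P (fst z)} \<subseteq> (\<lambda>z. z) -` (N \<times> T) \<inter> S \<times> T"
      using N(2) by (auto simp: mem_Times_iff)
  qed
qed

lemma AE_snd:
  assumes "AE y in lebesgue_on T. P y"
  shows "AE z in lebesgue_on (S \<times> T). P (snd z)"
proof -
  obtain N where N: "N \<in> null_sets (lebesgue_on T)" "\<And>y. y \<in> T \<Longrightarrow> \<not> P y \<Longrightarrow> y \<in> N"
    using AE_E3[OF assms] by (metis DiffI space_lebesgue_on)
  have "S \<times> N \<in> null_sets (lebesgue_on S \<Otimes>\<^sub>M lebesgue_on T)"
    using N(1) by (intro M2.times_in_null_sets2) simp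
  then have "S \<times> N \<in> null_sets (distr (lebesgue_on (S \<times> T)) (lebesgue_on S \<Otimes>\<^sub>M lebesgue_on T) (\<lambda>z. z))"
    by (simp add: distr_eq_pair)
  then have "(\<lambda>z. z) -` (S \<times> N) \<inter> S \<times> T \<in> null_sets (lebesgue_on (S \<times> T))"
    using null_sets_distr_iff[OF measurable_to_pair] by simp
  then show ?thesis
  proof (rule AE_I')
    show "{z \<in> space (lebesgue_on (S \<times> T)). \<not> P (snd z)} \<subseteq> (\<lambda>z. z) -` (S \<times> N) \<inter> S \<times> T"
      using N(2) by (auto simp: mem_Times_iff)
  qed
qed

lemma measurable_continuous_pair:
  fixes f :: "'a \<times> 'b \<Rightarrow> real"
  assumes "continuous_on UNIV f"
  shows "f \<in> borel_measurable (lebesgue_on S \<Otimes>\<^sub>M lebesgue_on T)"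
proof -
  have "(\<lambda>x. x) \<in> borel_measurable (lebesgue_on S)" "(\<lambda>y. y) \<in> borel_measurable (lebesgue_on T)"
    using id_borel_measurable_lebesgue_on by (auto simp: id_def)
  then have "(\<lambda>z. (fst z, snd z)) \<in> measurable (lebesgue_on S \<Otimes>\<^sub>M lebesgue_on T) (borel \<Otimes>\<^sub>M borel)"
    by (intro measurable_Pair measurable_compose[OF measurable_fst] measurable_compose[OF measurable_snd])
  then have "(\<lambda>z. z) \<in> borel_measurable (lebesgue_on S \<Otimes>\<^sub>M lebesgue_on T)"
    by (simp add: borel_prod)
  then show ?thesis
    using borel_measurable_continuous_onI[OF assms] by (rule measurable_compose)
qed

end

lemma (in lebesgue_product) integral_times:
  fixes f :: "'a \<Rightarrow> real" and g :: "'b \<Rightarrow> real"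
  assumes f: "integrable (lebesgue_on S) f" and g: "integrable (lebesgue_on T) g"
  shows "integrable (lebesgue_on (S \<times> T)) (\<lambda>z. f (fst z) * g (snd z))"
    and "(\<integral>z. f (fst z) * g (snd z) \<partial>lebesgue_on (S \<times> T)) =
      (\<integral>x. f x \<partial>lebesgue_on S) * (\<integral>y. g y \<partial>lebesgue_on T)"
proof -
  have [measurable]: "f \<in> borel_measurable (lebesgue_on S)" "g \<in> borel_measurable (lebesgue_on T)"
    using f g by auto
  have m: "(\<lambda>z. f (fst z) * g (snd z)) \<in> borel_measurable (lebesgue_on S \<Otimes>\<^sub>M lebesgue_on T)"
    by measurable
  have i: "integrable (lebesgue_on S \<Otimes>\<^sub>M lebesgue_on T) (\<lambda>z. f (fst z) * g (snd z))"
    by (rule Fubini_integrable[OF m]) (use f g in \<open>simp_all add: abs_mult\<close>)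
  then show "integrable (lebesgue_on (S \<times> T)) (\<lambda>z. f (fst z) * g (snd z))"
    by (simp add: integrable_pair_iff[OF m])
  show "(\<integral>z. f (fst z) * g (snd z) \<partial>lebesgue_on (S \<times> T)) =
      (\<integral>x. f x \<partial>lebesgue_on S) * (\<integral>y. g y \<partial>lebesgue_on T)"
    using integral_fst'[OF i] by (simp add: integral_pair_eq[OF m])
qed

section \<open>Square-integrable functions\<close>

lemma L2_iff: "f \<in> L2 S \<longleftrightarrow>
    f \<in> borel_measurable (lebesgue_on S) \<and> integrable (lebesgue_on S) (\<lambda>x. (f x)\<^sup>2)"
  by (simp add: L2w_def)

lemma L2_measurable: "f \<in> L2 S \<Longrightarrow> f \<in> borel_measurable (lebesgue_on S)"
  and L2_integrable: "f \<in> L2 S \<Longrightarrow> integrable (lebesgue_on S) (\<lambda>x. (f x)\<^sup>2)"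
  by (simp_all add: L2_iff)

lemma L2_integrable_mult:
  assumes "f \<in> L2 S" "g \<in> L2 S"
  shows "integrable (lebesgue_on S) (\<lambda>x. f x * g x)"
proof (rule Bochner_Integration.integrable_bound)
  show "integrable (lebesgue_on S) (\<lambda>x. (f x)\<^sup>2 + (g x)\<^sup>2)"
    using assms by (auto simp: L2_iff)
  show "(\<lambda>x. f x * g x) \<in> borel_measurable (lebesgue_on S)"
    using assms by (auto simp: L2_iff)
  have "\<bar>a * b\<bar> \<le> a\<^sup>2 + b\<^sup>2" for a b :: real
    using sum_squares_bound[of "\<bar>a\<bar>" "\<bar>b\<bar>"] mult_nonneg_nonneg[OF abs_ge_zero[of a] abs_ge_zero[of b]]
    unfolding abs_mult power2_abs by linarith
  then show "AE x in lebesgue_on S. norm (f x * g x) \<le> norm ((f x)\<^sup>2 + (g x)\<^sup>2)"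
    by simp
qed

lemma L2_add:
  assumes "f \<in> L2 S" "g \<in> L2 S"
  shows "(\<lambda>x. f x + g x) \<in> L2 S"
proof -
  have "(\<lambda>x. (f x + g x)\<^sup>2) = (\<lambda>x. (f x)\<^sup>2 + (g x)\<^sup>2 + 2 * (f x * g x))"
    by (auto simp: power2_sum)
  then show ?thesis
    using assms L2_integrable_mult[OF assms] by (auto simp: L2_iff)
qed

lemma L2_cmult: "f \<in> L2 S \<Longrightarrow> (\<lambda>x. k * f x) \<in> L2 S"
  by (auto simp: L2_iff power_mult_distrib)

lemma L2_diff: "f \<in> L2 S \<Longrightarrow> g \<in> L2 S \<Longrightarrow> (\<lambda>x. f x - g x) \<in> L2 S"
  using L2_add[of f S "\<lambda>x. - 1 * g x"] L2_cmult[of g S "-1"] by simp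

lemma L2_mult_bounded:
  assumes "f \<in> L2 S" "h \<in> borel_measurable (lebesgue_on S)" "\<And>x. x \<in> S \<Longrightarrow> \<bar>h x\<bar> \<le> B"
  shows "(\<lambda>x. h x * f x) \<in> L2 S"
proof -
  have "integrable (lebesgue_on S) (\<lambda>x. (h x * f x)\<^sup>2)"
  proof (rule Bochner_Integration.integrable_bound)
    show "integrable (lebesgue_on S) (\<lambda>x. B\<^sup>2 * (f x)\<^sup>2)"
      using assms(1) by (auto simp: L2_iff)
    have "(h x)\<^sup>2 \<le> B\<^sup>2" if "x \<in> S" for x
      using assms(3)[OF that] by (intro power2_le_iff_abs_le[THEN iffD2]) auto
    then show "AE x in lebesgue_on S. norm ((h x * f x)\<^sup>2) \<le> norm (B\<^sup>2 * (f x)\<^sup>2)"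
      by (intro AE_I2) (auto simp: power_mult_distrib mult_right_mono)
  qed (use assms in \<open>auto simp: L2_iff\<close>)
  then show ?thesis using assms by (auto simp: L2_iff)
qed

text \<open>A version of the Cauchy--Schwarz inequality, from the nonnegativity of
  \<open>\<integral>(t h + f)\<^sup>2\<close>; the summand \<open>1\<close> saves a separate treatment of \<open>h = 0\<close>.\<close>

lemma L2_Cauchy_Schwarz:
  assumes "h \<in> L2 S" "f \<in> L2 S"
  shows "(\<integral>x. h x * f x \<partial>lebesgue_on S)\<^sup>2 \<le>
    ((\<integral>x. (h x)\<^sup>2 \<partial>lebesgue_on S) + 1) * (\<integral>x. (f x)\<^sup>2 \<partial>lebesgue_on S)"
proof -
  define A where "A = (\<integral>x. (h x)\<^sup>2 \<partial>lebesgue_on S)"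
  define B where "B = (\<integral>x. h x * f x \<partial>lebesgue_on S)"
  define C where "C = (\<integral>x. (f x)\<^sup>2 \<partial>lebesgue_on S)"
  have A: "A \<ge> 0" unfolding A_def by simp
  define t where "t = - B / (A + 1)"
  have "0 \<le> (\<integral>x. (t * h x + f x)\<^sup>2 \<partial>lebesgue_on S)" by simp
  also have "\<dots> = (\<integral>x. t\<^sup>2 * (h x)\<^sup>2 + 2 * t * (h x * f x) + (f x)\<^sup>2 \<partial>lebesgue_on S)"
    by (simp add: power2_sum power_mult_distrib algebra_simps)
  also have "\<dots> = t\<^sup>2 * A + 2 * t * B + C"
    using assms L2_integrable_mult[OF assms] by (simp add: L2_iff A_def B_def C_def)
  also have "\<dots> \<le> t\<^sup>2 * (A + 1) + 2 * t * B + C"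
    by (simp add: algebra_simps)
  also have "\<dots> = C - B\<^sup>2 / (A + 1)"
    using A by (simp add: t_def power2_eq_square divide_simps)
  finally have "B\<^sup>2 \<le> (A + 1) * C"
    using A by (simp add: divide_simps mult.commute)
  then show ?thesis by (simp add: A_def B_def C_def)
qed

lemma L2_integral_mult_tendsto:
  assumes h: "h \<in> L2 S" and f: "f \<in> L2 S" and fn: "\<And>n. F n \<in> L2 S"
    and lim: "(\<lambda>n. \<integral>x. (f x - F n x)\<^sup>2 \<partial>lebesgue_on S) \<longlonglongrightarrow> 0"
  shows "(\<lambda>n. \<integral>x. h x * F n x \<partial>lebesgue_on S) \<longlonglongrightarrow> (\<integral>x. h x * f x \<partial>lebesgue_on S)"
proof -
  let ?I = "\<lambda>k. \<integral>x. k x \<partial>lebesgue_on S"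
  have "(\<lambda>n. (?I (\<lambda>x. h x * (f x - F n x)))\<^sup>2) \<longlonglongrightarrow> 0"
  proof (rule tendsto_sandwich[OF _ _ tendsto_const])
    show "\<forall>\<^sub>F n in sequentially. (?I (\<lambda>x. h x * (f x - F n x)))\<^sup>2
        \<le> (?I (\<lambda>x. (h x)\<^sup>2) + 1) * ?I (\<lambda>x. (f x - F n x)\<^sup>2)"
      by (intro always_eventually allI L2_Cauchy_Schwarz h L2_diff f fn)
    show "(\<lambda>n. (?I (\<lambda>x. (h x)\<^sup>2) + 1) * ?I (\<lambda>x. (f x - F n x)\<^sup>2)) \<longlonglongrightarrow> 0"
      using tendsto_mult_left[OF lim] by simp
  qed simp
  then have "(\<lambda>n. ?I (\<lambda>x. h x * (f x - F n x))) \<longlonglongrightarrow> 0"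
    by (auto dest: tendsto_real_sqrt simp: tendsto_rabs_zero_iff)
  moreover have "?I (\<lambda>x. h x * (f x - F n x)) = ?I (\<lambda>x. h x * f x) - ?I (\<lambda>x. h x * F n x)" for n
    using L2_integrable_mult[OF h f] L2_integrable_mult[OF h fn] by (simp add: right_diff_distrib)
  ultimately have "(\<lambda>n. ?I (\<lambda>x. h x * f x) - ?I (\<lambda>x. h x * F n x)) \<longlonglongrightarrow> 0" by simp
  from tendsto_diff[OF tendsto_const[of "?I (\<lambda>x. h x * f x)"] this] show ?thesis by simp
qed

lemma test_functions_L2:
  assumes "\<psi> \<in> test_functions S" "S \<in> sets lebesgue"
  shows "\<psi> \<in> L2 S"
proof -
  obtain K where K: "compact K" "\<And>x. x \<notin> K \<Longrightarrow> \<psi> x = 0"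
    using test_functions_support[OF assms(1)] by blast
  have c: "continuous_on A \<psi>" for A
    using assms(1) by (intro smooth_continuous_on test_functions_smooth)
  have "integrable lborel (\<lambda>x. indicator K x *\<^sub>R (\<psi> x)\<^sup>2)"
    by (intro borel_integrable_compact K continuous_intros c)
  moreover have "(\<lambda>x. indicator K x *\<^sub>R (\<psi> x)\<^sup>2) = (\<lambda>x. (\<psi> x)\<^sup>2)"
  proof
    show "indicator K x *\<^sub>R (\<psi> x)\<^sup>2 = (\<psi> x)\<^sup>2" for x
      using K(2)[of x] by (cases "x \<in> K") auto
  qed
  ultimately have "integrable lebesgue (\<lambda>x. (\<psi> x)\<^sup>2)"
    by (simp add: integrable_completion)
  from integrable_mult_indicator[OF assms(2) this]
  have "integrable (lebesgue_on S) (\<lambda>x. (\<psi> x)\<^sup>2)"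
    using assms(2) by (subst integrable_restrict_space) simp_all
  moreover have "\<psi> \<in> borel_measurable (lebesgue_on S)"
    by (intro measurable_restrict_space1 measurable_completion)
       (use borel_measurable_continuous_onI[OF c] in simp)
  ultimately show ?thesis by (simp add: L2_iff)
qed

section \<open>Tensor products in Sobolev spaces\<close>

lemma tensor_apply: "tensor f g z = f (fst z) * g (snd z)"
  by (simp add: tensor_def case_prod_unfold)

locale real_lebesgue_product = lebesgue_product S T
  for S :: "'a::euclidean_space set" and T :: "real set"
begin

lemma tensor_measurable_pair:
  assumes "f \<in> borel_measurable (lebesgue_on S)" "g \<in> borel_measurable (lebesgue_on T)"
  shows "tensor f g \<in> borel_measurable (lebesgue_on S \<Otimes>\<^sub>M lebesgue_on T)"
  using assms unfolding tensor_apply[abs_def] by measurable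

lemma integral_tensor:
  assumes "integrable (lebesgue_on S) f" "integrable (lebesgue_on T) g"
  shows "integrable (lebesgue_on (S \<times> T)) (tensor f g)"
    and "(\<integral>z. tensor f g z \<partial>lebesgue_on (S \<times> T)) =
      (\<integral>x. f x \<partial>lebesgue_on S) * (\<integral>y. g y \<partial>lebesgue_on T)"
  using integral_times[OF assms] unfolding tensor_apply[abs_def] by auto

lemma L2w_tensor:
  assumes "f \<in> L2 S" "g \<in> L2w T w"
  shows "tensor f g \<in> L2w (S \<times> T) (\<lambda>z. w (snd z))"
  using integral_tensor(1)[of "\<lambda>x. (f x)\<^sup>2" "\<lambda>y. (g y)\<^sup>2 * w y"] assms
    measurable_pair_imp[OF tensor_measurable_pair, of f g]
  by (simp add: L2w_def tensor_apply[abs_def] power_mult_distrib mult.assoc)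

lemma L2_tensor: "f \<in> L2 S \<Longrightarrow> g \<in> L2 T \<Longrightarrow> tensor f g \<in> L2 (S \<times> T)"
  using L2w_tensor[of f g "\<lambda>_. 1"] by simp

lemma integral_tensor_square:
  assumes "f \<in> L2 S" "g \<in> L2 T"
  shows "(\<integral>z. (tensor f g z)\<^sup>2 \<partial>lebesgue_on (S \<times> T)) =
    (\<integral>x. (f x)\<^sup>2 \<partial>lebesgue_on S) * (\<integral>y. (g y)\<^sup>2 \<partial>lebesgue_on T)"
  using integral_tensor(2)[OF L2_integrable[OF assms(1)] L2_integrable[OF assms(2)]]
  by (simp add: tensor_apply[abs_def] power_mult_distrib)

text \<open>Restricted to a horizontal or vertical slice, a test function on the product is a test
  function on the factor, so both weak derivatives follow from the one-factor identity on each
  slice by Fubini's theorem.\<close>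

lemma weak_deriv_tensor_fst:
  assumes f: "weak_deriv S v f f'" and g: "g \<in> L2 T"
  shows "weak_deriv (S \<times> T) (v, 0) (tensor f g) (tensor f' g)"
proof -
  have L: "f \<in> L2 S" "f' \<in> L2 S" using f by (auto simp: weak_deriv_def)
  have ST: "S \<times> T \<in> sets lebesgue" by (intro lebesgue_Times S T)
  have "(\<integral>z. tensor f g z * frechet_derivative \<psi> (at z) (v, 0) \<partial>lebesgue_on (S \<times> T)) =
      - (\<integral>z. tensor f' g z * \<psi> z \<partial>lebesgue_on (S \<times> T))"
    if \<psi>: "\<psi> \<in> test_functions (S \<times> T)" for \<psi>
  proof -
    have iter: "(\<integral>z. tensor h g z * \<theta> z \<partial>lebesgue_on (S \<times> T)) =
        (\<integral>y. g y * (\<integral>x. h x * \<theta> (x, y) \<partial>lebesgue_on S) \<partial>lebesgue_on T)"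
      if h: "h \<in> L2 S" and \<theta>: "\<theta> \<in> test_functions (S \<times> T)" for h \<theta>
    proof -
      have m: "(\<lambda>z. tensor h g z * \<theta> z) \<in> borel_measurable (lebesgue_on S \<Otimes>\<^sub>M lebesgue_on T)"
        using h g \<theta>
        by (intro borel_measurable_times tensor_measurable_pair measurable_continuous_pair
            smooth_continuous_on test_functions_smooth L2_measurable)
      have "integrable (lebesgue_on (S \<times> T)) (\<lambda>z. tensor h g z * \<theta> z)"
        using h g \<theta> ST by (intro L2_integrable_mult[OF L2_tensor test_functions_L2])
      then have "integrable (lebesgue_on S \<Otimes>\<^sub>M lebesgue_on T) (\<lambda>z. tensor h g z * \<theta> z)"
        by (simp only: integrable_pair_iff[OF m])
      also have eq: "(\<lambda>z. tensor h g z * \<theta> z) = (\<lambda>(x, y). g y * (h x * \<theta> (x, y)))"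
        by (auto simp: tensor_def)
      finally show ?thesis
        unfolding integral_pair_eq[OF m] unfolding eq by (simp add: integral_snd[symmetric])
    qed
    have "(\<integral>x. f x * frechet_derivative \<psi> (at (x, y)) (v, 0) \<partial>lebesgue_on S) =
        - (\<integral>x. f' x * \<psi> (x, y) \<partial>lebesgue_on S)" for y
      using f test_functions_slice(1)[OF \<psi>, of y]
      by (simp add: weak_deriv_def test_functions_slice(2)[OF \<psi>, symmetric])
    then show ?thesis
      by (simp add: iter L test_functions_frechet_derivative \<psi>)
  qed
  then show ?thesis
    using L g by (simp add: weak_deriv_def L2_tensor)
qed

lemma weak_deriv_tensor_snd:
  assumes f: "f \<in> L2 S" and g: "weak_deriv T w g g'"
  shows "weak_deriv (S \<times> T) (0, w) (tensor f g) (tensor f g')"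
proof -
  have L: "g \<in> L2 T" "g' \<in> L2 T" using g by (auto simp: weak_deriv_def)
  have ST: "S \<times> T \<in> sets lebesgue" by (intro lebesgue_Times S T)
  have "(\<integral>z. tensor f g z * frechet_derivative \<psi> (at z) (0, w) \<partial>lebesgue_on (S \<times> T)) =
      - (\<integral>z. tensor f g' z * \<psi> z \<partial>lebesgue_on (S \<times> T))"
    if \<psi>: "\<psi> \<in> test_functions (S \<times> T)" for \<psi>
  proof -
    have iter: "(\<integral>z. tensor f h z * \<theta> z \<partial>lebesgue_on (S \<times> T)) =
        (\<integral>x. f x * (\<integral>y. h y * \<theta> (x, y) \<partial>lebesgue_on T) \<partial>lebesgue_on S)"
      if h: "h \<in> L2 T" and \<theta>: "\<theta> \<in> test_functions (S \<times> T)" for h \<theta>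
    proof -
      have m: "(\<lambda>z. tensor f h z * \<theta> z) \<in> borel_measurable (lebesgue_on S \<Otimes>\<^sub>M lebesgue_on T)"
        using h f \<theta>
        by (intro borel_measurable_times tensor_measurable_pair measurable_continuous_pair
            smooth_continuous_on test_functions_smooth L2_measurable)
      have "integrable (lebesgue_on (S \<times> T)) (\<lambda>z. tensor f h z * \<theta> z)"
        using h f \<theta> ST by (intro L2_integrable_mult[OF L2_tensor test_functions_L2])
      then have "integrable (lebesgue_on S \<Otimes>\<^sub>M lebesgue_on T) (\<lambda>z. tensor f h z * \<theta> z)"
        by (simp only: integrable_pair_iff[OF m])
      also have eq: "(\<lambda>z. tensor f h z * \<theta> z) = (\<lambda>(x, y). f x * (h y * \<theta> (x, y)))"
        by (auto simp: tensor_def)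
      finally show ?thesis
        unfolding integral_pair_eq[OF m] unfolding eq by (simp add: integral_fst[symmetric])
    qed
    have "(\<integral>y. g y * frechet_derivative \<psi> (at (x, y)) (0, w) \<partial>lebesgue_on T) =
        - (\<integral>y. g' y * \<psi> (x, y) \<partial>lebesgue_on T)" for x
      using g test_functions_slice(3)[OF \<psi>, of x]
      by (simp add: weak_deriv_def test_functions_slice(4)[OF \<psi>, symmetric])
    then show ?thesis
      by (simp add: iter L test_functions_frechet_derivative \<psi>)
  qed
  then show ?thesis
    using L f by (simp add: weak_deriv_def L2_tensor)
qed

lemma L2_tendsto_tensor:
  assumes f: "f \<in> L2 S" "\<And>n. F n \<in> L2 S" "(\<lambda>n. \<integral>x. (f x - F n x)\<^sup>2 \<partial>lebesgue_on S) \<longlonglongrightarrow> 0"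
    and g: "g \<in> L2 T" "\<And>n. G n \<in> L2 T" "(\<lambda>n. \<integral>y. (g y - G n y)\<^sup>2 \<partial>lebesgue_on T) \<longlonglongrightarrow> 0"
  shows "(\<lambda>n. \<integral>z. (tensor f g z - tensor (F n) (G n) z)\<^sup>2 \<partial>lebesgue_on (S \<times> T)) \<longlonglongrightarrow> 0"
proof -
  let ?I = "\<lambda>h. \<integral>x. (h x)\<^sup>2 \<partial>lebesgue_on S" and ?J = "\<lambda>h. \<integral>y. (h y)\<^sup>2 \<partial>lebesgue_on T"
  let ?f = "\<lambda>n x. f x - F n x" and ?g = "\<lambda>n y. g y - G n y"
  let ?R = "\<lambda>n. 3 * (?I (?f n) * ?J g + ?I f * ?J (?g n) + ?I (?f n) * ?J (?g n))"
  have le: "(\<integral>z. (tensor f g z - tensor (F n) (G n) z)\<^sup>2 \<partial>lebesgue_on (S \<times> T)) \<le> ?R n" for n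
  proof -
    have L: "?f n \<in> L2 S" "?g n \<in> L2 T" using f g by (auto intro: L2_diff)
    have tri: "(a * b - c * d)\<^sup>2 \<le> 3 * (((a - c) * b)\<^sup>2 + (a * (b - d))\<^sup>2 + ((a - c) * (b - d))\<^sup>2)"
      for a b c d :: real
    proof -
      have "a * b - c * d = (a - c) * b + a * (b - d) - (a - c) * (b - d)" by (simp add: algebra_simps)
      moreover have "(p + q - r)\<^sup>2 \<le> 3 * (p\<^sup>2 + q\<^sup>2 + r\<^sup>2)" for p q r :: real
      proof -
        have "3 * (p\<^sup>2 + q\<^sup>2 + r\<^sup>2) - (p + q - r)\<^sup>2 = (p - q)\<^sup>2 + (p + r)\<^sup>2 + (q + r)\<^sup>2"
          by (simp add: power2_eq_square algebra_simps)
        then show ?thesis by (smt (verit) zero_le_power2)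
      qed
      ultimately show ?thesis by metis
    qed
    have i: "integrable (lebesgue_on (S \<times> T)) (\<lambda>z. (tensor h k z)\<^sup>2)" if "h \<in> L2 S" "k \<in> L2 T" for h k
      using L2_integrable[OF L2_tensor[OF that]] .
    have "(\<integral>z. (tensor f g z - tensor (F n) (G n) z)\<^sup>2 \<partial>lebesgue_on (S \<times> T)) \<le>
        (\<integral>z. 3 * ((tensor (?f n) g z)\<^sup>2 + (tensor f (?g n) z)\<^sup>2 + (tensor (?f n) (?g n) z)\<^sup>2)
          \<partial>lebesgue_on (S \<times> T))"
    proof (rule integral_mono)
      show "integrable (lebesgue_on (S \<times> T)) (\<lambda>z. (tensor f g z - tensor (F n) (G n) z)\<^sup>2)"
        using f g by (intro L2_integrable L2_diff L2_tensor)
      show "integrable (lebesgue_on (S \<times> T))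
          (\<lambda>z. 3 * ((tensor (?f n) g z)\<^sup>2 + (tensor f (?g n) z)\<^sup>2 + (tensor (?f n) (?g n) z)\<^sup>2))"
        using f g L by (intro integrable_mult_right Bochner_Integration.integrable_add i)
    qed (use tri in \<open>simp add: tensor_apply\<close>)
    also have "\<dots> = ?R n"
      using f g L by (simp add: i integral_tensor_square)
    finally show ?thesis .
  qed
  have "?R \<longlonglongrightarrow> 3 * (0 * ?J g + ?I f * 0 + 0 * 0)"
    by (intro tendsto_intros f(3) g(3))
  then have "?R \<longlonglongrightarrow> 0" by simp
  then show ?thesis
    by (rule tendsto_sandwich[OF _ _ tendsto_const, rotated 2])
       (use le in \<open>auto intro!: always_eventually\<close>)
qed

lemma H1_tensor:
  assumes f: "f \<in> H1 S" and g: "g \<in> H1 T"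
  shows "tensor f g \<in> H1 (S \<times> T)"
proof -
  have L: "f \<in> L2 S" "g \<in> L2 T" using f g by (auto simp: H1_def)
  have "\<exists>h. weak_deriv (S \<times> T) (b, 0) (tensor f g) h" if "b \<in> Basis" for b
    using f that L weak_deriv_tensor_fst by (fastforce simp: H1_def)
  moreover have "\<exists>h. weak_deriv (S \<times> T) (0, 1) (tensor f g) h"
    using g L weak_deriv_tensor_snd by (fastforce simp: H1_def)
  ultimately show ?thesis
    using L by (auto simp: H1_def L2_tensor Basis_prod_def)
qed

lemma H2_tensor:
  assumes f: "f \<in> H2 S" and g: "g \<in> H2 T"
  shows "tensor f g \<in> H2 (S \<times> T)"
proof -
  have H: "f \<in> H1 S" "g \<in> H1 T" using f g by (auto simp: H2_def)
  have L: "f \<in> L2 S" "g \<in> L2 T" using H by (auto simp: H1_def)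
  have "\<exists>h\<in>H1 (S \<times> T). weak_deriv (S \<times> T) (b, 0) (tensor f g) h" if "b \<in> Basis" for b
    using f that L H weak_deriv_tensor_fst H1_tensor by (fastforce simp: H2_def)
  moreover have "\<exists>h\<in>H1 (S \<times> T). weak_deriv (S \<times> T) (0, 1) (tensor f g) h"
    using g L H weak_deriv_tensor_snd H1_tensor by (fastforce simp: H2_def)
  ultimately show ?thesis
    using H by (auto simp: H2_def H1_tensor Basis_prod_def)
qed

lemma H10_tensor:
  assumes f: "f \<in> H10 S" and g: "g \<in> H10 T"
  shows "tensor f g \<in> H10 (S \<times> T)"
proof -
  have L: "f \<in> L2 S" "g \<in> L2 T" using f g by (auto simp: H10_def H1_def)
  obtain F where F: "\<And>n. F n \<in> test_functions S"
      "(\<lambda>n. \<integral>x. (f x - F n x)\<^sup>2 \<partial>lebesgue_on S) \<longlonglongrightarrow> 0"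
    and F': "\<And>b. b \<in> Basis \<Longrightarrow> \<exists>f'. weak_deriv S b f f' \<and>
        (\<lambda>n. \<integral>x. (f' x - frechet_derivative (F n) (at x) b)\<^sup>2 \<partial>lebesgue_on S) \<longlonglongrightarrow> 0"
    using f unfolding H10_def by blast
  obtain G g' where G: "\<And>n. G n \<in> test_functions T"
      "(\<lambda>n. \<integral>y. (g y - G n y)\<^sup>2 \<partial>lebesgue_on T) \<longlonglongrightarrow> 0"
    and G': "weak_deriv T 1 g g'"
      "(\<lambda>n. \<integral>y. (g' y - frechet_derivative (G n) (at y) 1)\<^sup>2 \<partial>lebesgue_on T) \<longlonglongrightarrow> 0"
    using g unfolding H10_def by auto
  have FL: "F n \<in> L2 S" "(\<lambda>x. frechet_derivative (F n) (at x) v) \<in> L2 S" for n v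
    using test_functions_L2[OF F(1) S]
      test_functions_L2[OF test_functions_frechet_derivative[OF F(1)] S] by auto
  have GL: "G n \<in> L2 T" "(\<lambda>x. frechet_derivative (G n) (at x) v) \<in> L2 T" for n v
    using test_functions_L2[OF G(1) T]
      test_functions_L2[OF test_functions_frechet_derivative[OF G(1)] T] by auto
  have sm: "smooth (F n)" "smooth (G n)" for n
    using F(1) G(1) by (auto dest: test_functions_smooth)
  have D1: "frechet_derivative (tensor (F n) (G n)) (at z) (v, 0) =
      tensor (\<lambda>x. frechet_derivative (F n) (at x) v) (G n) z" for n z v
    by (simp add: tensor_derivative sm tensor_apply smooth_frechet_derivative_0)
  have D2: "frechet_derivative (tensor (F n) (G n)) (at z) (0, w) =
      tensor (F n) (\<lambda>x. frechet_derivative (G n) (at x) w) z" for n z w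
    by (simp add: tensor_derivative sm tensor_apply smooth_frechet_derivative_0)
  have "\<exists>h. weak_deriv (S \<times> T) c (tensor f g) h \<and>
      (\<lambda>n. \<integral>z. (h z - frechet_derivative (tensor (F n) (G n)) (at z) c)\<^sup>2 \<partial>lebesgue_on (S \<times> T)) \<longlonglongrightarrow> 0"
    if c: "c \<in> Basis" for c
  proof -
    consider b where "c = (b, 0)" "b \<in> Basis" | "c = (0, 1)"
      using c by (auto simp: Basis_prod_def)
    then show ?thesis
    proof cases
      case (1 b)
      obtain f' where f': "weak_deriv S b f f'"
          "(\<lambda>n. \<integral>x. (f' x - frechet_derivative (F n) (at x) b)\<^sup>2 \<partial>lebesgue_on S) \<longlonglongrightarrow> 0"
        using F'[OF 1(2)] by blast
      then have "f' \<in> L2 S" by (simp add: weak_deriv_def)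
      then show ?thesis
        using weak_deriv_tensor_fst[OF f'(1) L(2)]
          L2_tendsto_tensor[OF _ FL(2) f'(2) L(2) GL(1) G(2)]
        by (auto simp: 1 D1)
    next
      case 2
      have "g' \<in> L2 T" using G' by (simp add: weak_deriv_def)
      then show ?thesis
        using weak_deriv_tensor_snd[OF L(1) G'(1)]
          L2_tendsto_tensor[OF L(1) FL(1) F(2) _ GL(2) G'(2)]
        by (auto simp: 2 D2)
    qed
  qed
  moreover have "tensor (F n) (G n) \<in> test_functions (S \<times> T)" for n
    using F(1) G(1) by (rule test_functions_tensor)
  moreover have "(\<lambda>n. \<integral>z. (tensor f g z - tensor (F n) (G n) z)\<^sup>2 \<partial>lebesgue_on (S \<times> T)) \<longlonglongrightarrow> 0"
    by (intro L2_tendsto_tensor L FL GL F G)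
  moreover have "tensor f g \<in> H1 (S \<times> T)"
    using f g by (auto simp: H10_def intro: H1_tensor)
  ultimately show ?thesis
    unfolding H10_def by (intro CollectI conjI exI[of _ "\<lambda>n. tensor (F n) (G n)"] allI ballI)
qed

end

section \<open>The weighted energy identity\<close>

lemma bounded_on_interval:
  fixes f :: "real \<Rightarrow> real"
  assumes "continuous_on {a..b} f"
  obtains B where "\<And>x. x \<in> {a..b} \<Longrightarrow> \<bar>f x\<bar> \<le> B"
proof -
  have "bounded (f ` {a..b})"
    by (intro compact_imp_bounded compact_continuous_image assms compact_Icc)
  then obtain B where "\<forall>y\<in>f ` {a..b}. norm y \<le> B" by (auto simp: bounded_iff)
  then show thesis using that[of B] by auto
qed

lemma continuous_measurable_lebesgue_on:
  fixes f :: "real \<Rightarrow> real"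
  assumes "continuous_on UNIV f"
  shows "f \<in> borel_measurable (lebesgue_on S)"
  by (intro measurable_restrict_space1 measurable_completion)
     (use borel_measurable_continuous_onI[OF assms] in simp)

lemma L2_smooth_mult:
  fixes f :: "real \<Rightarrow> real"
  assumes "smooth \<eta>" "f \<in> L2 {0<..<H}"
  shows "(\<lambda>x. \<eta> x * f x) \<in> L2 {0<..<H}"
proof -
  obtain B where "\<And>x. x \<in> {0..H} \<Longrightarrow> \<bar>\<eta> x\<bar> \<le> B"
    using bounded_on_interval[OF smooth_continuous_on[OF assms(1)]] by blast
  then show ?thesis
    using assms by (intro L2_mult_bounded[where B = B] continuous_measurable_lebesgue_on
        smooth_continuous_on) auto
qed

text \<open>The function \<open>g\<close> is the derivative of \<open>u\<close> supplied by \<open>H\<^sup>1\<^sub>0\<close>, \<open>u'\<close> the one supplied by \<open>H\<^sup>2\<close>. Their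
  comparison goes through test functions: the derivatives of the functions approximating \<open>u\<close> are
  test functions too, and against test functions \<open>g\<close> and \<open>u'\<close> have the same integrals.\<close>

lemma energy_identity_smooth:
  fixes u u' u'' :: "real \<Rightarrow> real"
  assumes u: "u \<in> H10 {0<..<H}" and u': "weak_deriv {0<..<H} 1 u u'"
    and u'': "weak_deriv {0<..<H} 1 u' u''"
  shows "\<exists>g. g \<in> L2 {0<..<H} \<and> (\<integral>x. u x * g x \<partial>lebesgue_on {0<..<H}) = 0 \<and>
    (\<forall>\<eta>. smooth \<eta> \<longrightarrow> (\<integral>x. \<eta> x * ((g x)\<^sup>2 + u'' x * u x)
        + frechet_derivative \<eta> (at x) 1 * (u x * g x) \<partial>lebesgue_on {0<..<H}) = 0)"
proof -
  let ?I = "{0<..<H}"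
  let ?int = "\<lambda>f. \<integral>x. f x \<partial>lebesgue_on ?I"
  let ?d = "\<lambda>f x. frechet_derivative f (at x) (1::real)"
  obtain \<psi> g where \<psi>: "\<And>n. \<psi> n \<in> test_functions ?I" "(\<lambda>n. ?int (\<lambda>x. (u x - \<psi> n x)\<^sup>2)) \<longlonglongrightarrow> 0"
    and g: "weak_deriv ?I 1 u g" and \<psi>': "(\<lambda>n. ?int (\<lambda>x. (g x - ?d (\<psi> n) x)\<^sup>2)) \<longlonglongrightarrow> 0"
    using u unfolding H10_def by auto
  have L: "u \<in> L2 ?I" "g \<in> L2 ?I" "u' \<in> L2 ?I" "u'' \<in> L2 ?I"
    using u' u'' g by (auto simp: weak_deriv_def)
  have \<psi>L: "\<psi> n \<in> L2 ?I" "?d (\<psi> n) \<in> L2 ?I" for n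
    using test_functions_L2[OF \<psi>(1)]
      test_functions_L2[OF test_functions_frechet_derivative[OF \<psi>(1)]] by auto
  have gu': "?int (\<lambda>x. g x * \<theta> x) = ?int (\<lambda>x. u' x * \<theta> x)" if "\<theta> \<in> test_functions ?I" for \<theta>
    using g u' that by (simp add: weak_deriv_def)
  have "?int (\<lambda>x. u x * g x) = 0"
  proof -
    have "?int (\<lambda>x. u x * ?d (\<psi> n) x) = - ?int (\<lambda>x. g x * \<psi> n x)" for n
      using g \<psi>(1) by (simp add: weak_deriv_def)
    moreover have "(\<lambda>n. ?int (\<lambda>x. u x * ?d (\<psi> n) x)) \<longlonglongrightarrow> ?int (\<lambda>x. u x * g x)"
      by (intro L2_integral_mult_tendsto L \<psi>L \<psi>')
    moreover have "(\<lambda>n. - ?int (\<lambda>x. g x * \<psi> n x)) \<longlonglongrightarrow> - ?int (\<lambda>x. g x * u x)"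
      by (intro tendsto_minus L2_integral_mult_tendsto L \<psi>L \<psi>(2))
    ultimately have "?int (\<lambda>x. u x * g x) = - ?int (\<lambda>x. g x * u x)"
      using LIMSEQ_unique by simp
    then show ?thesis by (simp add: mult.commute)
  qed
  moreover have "?int (\<lambda>x. \<eta> x * ((g x)\<^sup>2 + u'' x * u x) + ?d \<eta> x * (u x * g x)) = 0"
    if \<eta>: "smooth \<eta>" for \<eta>
  proof -
    have \<eta>': "smooth (?d \<eta>)" using \<eta> by (rule smooth_frechet_derivative)
    \<comment> \<open>the weak equation for \<open>u'\<close>, tested with \<open>\<eta>\<psi>\<^sub>n\<close>, after replacing \<open>u'\<close> by \<open>g\<close>\<close>
    have eq: "?int (\<lambda>x. (?d \<eta> x * g x) * \<psi> n x) + ?int (\<lambda>x. (\<eta> x * g x) * ?d (\<psi> n) x)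
        = - ?int (\<lambda>x. (\<eta> x * u'' x) * \<psi> n x)" for n
    proof -
      have "?d (\<lambda>x. \<eta> x * \<psi> n x) x = ?d \<eta> x * \<psi> n x + \<eta> x * ?d (\<psi> n) x" for x
        using frechet_derivative_at[OF has_derivative_mult[OF smooth_has_derivative[OF \<eta>, of x]
              smooth_has_derivative[OF test_functions_smooth[OF \<psi>(1)[of n]], of x]], symmetric]
        by simp
      moreover have "?int (\<lambda>x. u' x * ?d (\<lambda>x. \<eta> x * \<psi> n x) x) = - ?int (\<lambda>x. u'' x * (\<eta> x * \<psi> n x))"
        using u'' test_functions_mult[OF \<eta> \<psi>(1)] unfolding weak_deriv_def by blast
      ultimately have "?int (\<lambda>x. u' x * (?d \<eta> x * \<psi> n x + \<eta> x * ?d (\<psi> n) x))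
          = - ?int (\<lambda>x. u'' x * (\<eta> x * \<psi> n x))" by (simp only:)
      moreover have "?int (\<lambda>x. u' x * (?d \<eta> x * \<psi> n x + \<eta> x * ?d (\<psi> n) x)) =
          ?int (\<lambda>x. u' x * (?d \<eta> x * \<psi> n x)) + ?int (\<lambda>x. u' x * (\<eta> x * ?d (\<psi> n) x))"
        using L2_integrable_mult[OF L(3) L2_smooth_mult[OF \<eta>' \<psi>L(1)]]
          L2_integrable_mult[OF L(3) L2_smooth_mult[OF \<eta> \<psi>L(2)]]
        by (simp add: distrib_left)
      ultimately show ?thesis
        using gu'[OF test_functions_mult[OF \<eta>' \<psi>(1)]]
          gu'[OF test_functions_mult[OF \<eta> test_functions_frechet_derivative[OF \<psi>(1)]]]
        by (simp add: ac_simps)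
    qed
    have "(\<lambda>n. ?int (\<lambda>x. (?d \<eta> x * g x) * \<psi> n x) + ?int (\<lambda>x. (\<eta> x * g x) * ?d (\<psi> n) x))
        \<longlonglongrightarrow> ?int (\<lambda>x. (?d \<eta> x * g x) * u x) + ?int (\<lambda>x. (\<eta> x * g x) * g x)"
      by (intro tendsto_add L2_integral_mult_tendsto L2_smooth_mult \<eta> \<eta>' L \<psi>L \<psi>(2) \<psi>')
    moreover have "(\<lambda>n. - ?int (\<lambda>x. (\<eta> x * u'' x) * \<psi> n x)) \<longlonglongrightarrow> - ?int (\<lambda>x. (\<eta> x * u'' x) * u x)"
      by (intro tendsto_minus L2_integral_mult_tendsto L2_smooth_mult \<eta> L \<psi>L \<psi>(2))
    ultimately have "?int (\<lambda>x. (?d \<eta> x * g x) * u x) + ?int (\<lambda>x. (\<eta> x * g x) * g x)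
        = - ?int (\<lambda>x. (\<eta> x * u'' x) * u x)"
      using LIMSEQ_unique by (simp add: eq)
    moreover have "?int (\<lambda>x. \<eta> x * ((g x)\<^sup>2 + u'' x * u x) + ?d \<eta> x * (u x * g x)) =
        ?int (\<lambda>x. (\<eta> x * g x) * g x + (\<eta> x * u'' x) * u x + (?d \<eta> x * g x) * u x)"
      by (simp add: power2_eq_square algebra_simps)
    moreover have "\<dots> = ?int (\<lambda>x. (\<eta> x * g x) * g x) + ?int (\<lambda>x. (\<eta> x * u'' x) * u x)
        + ?int (\<lambda>x. (?d \<eta> x * g x) * u x)"
      using L2_integrable_mult[OF L2_smooth_mult[OF \<eta> L(2)] L(2)]
        L2_integrable_mult[OF L2_smooth_mult[OF \<eta> L(4)] L(1)]
        L2_integrable_mult[OF L2_smooth_mult[OF \<eta>' L(2)] L(1)] by simp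
    ultimately show ?thesis by simp
  qed
  ultimately show ?thesis using L(2) by blast
qed

text \<open>Both extensions of the class of weights below are limits of this kind: weight and derivative
  converge boundedly and pointwise.\<close>

lemma weighted_integral_tendsto:
  fixes e h :: "real \<Rightarrow> real"
  assumes e: "integrable (lebesgue_on S) e" and h: "integrable (lebesgue_on S) h"
    and meas: "\<And>n. F n \<in> borel_measurable (lebesgue_on S)" "\<And>n. G n \<in> borel_measurable (lebesgue_on S)"
    and bound: "\<And>n x. x \<in> S \<Longrightarrow> \<bar>F n x\<bar> \<le> B" "\<And>n x. x \<in> S \<Longrightarrow> \<bar>G n x\<bar> \<le> B"
    and lim: "\<And>x. x \<in> S \<Longrightarrow> (\<lambda>n. F n x) \<longlonglongrightarrow> f x" "\<And>x. x \<in> S \<Longrightarrow> (\<lambda>n. G n x) \<longlonglongrightarrow> g x"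
  shows "integrable (lebesgue_on S) (\<lambda>x. f x * e x + g x * h x)"
    and "(\<lambda>n. \<integral>x. F n x * e x + G n x * h x \<partial>lebesgue_on S) \<longlonglongrightarrow>
      (\<integral>x. f x * e x + g x * h x \<partial>lebesgue_on S)"
proof -
  have [measurable]: "e \<in> borel_measurable (lebesgue_on S)" "h \<in> borel_measurable (lebesgue_on S)"
    using e h by auto
  note meas[measurable]
  have [measurable]: "f \<in> borel_measurable (lebesgue_on S)"
    by (rule borel_measurable_LIMSEQ_metric[OF meas(1)]) (use lim in simp)
  have [measurable]: "g \<in> borel_measurable (lebesgue_on S)"
    by (rule borel_measurable_LIMSEQ_metric[OF meas(2)]) (use lim in simp)
  have 1: "(\<lambda>x. f x * e x + g x * h x) \<in> borel_measurable (lebesgue_on S)" by measurable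
  have 2: "(\<lambda>x. F n x * e x + G n x * h x) \<in> borel_measurable (lebesgue_on S)" for n by measurable
  have 3: "integrable (lebesgue_on S) (\<lambda>x. B * \<bar>e x\<bar> + B * \<bar>h x\<bar>)"
    using e h by auto
  have 4: "AE x in lebesgue_on S. (\<lambda>n. F n x * e x + G n x * h x) \<longlonglongrightarrow> f x * e x + g x * h x"
    using lim by (intro AE_I2 tendsto_intros) auto
  have "\<bar>F n x * e x + G n x * h x\<bar> \<le> B * \<bar>e x\<bar> + B * \<bar>h x\<bar>" if "x \<in> S" for n x
    using mult_right_mono[OF bound(1)[OF that, of n] abs_ge_zero[of "e x"]]
      mult_right_mono[OF bound(2)[OF that, of n] abs_ge_zero[of "h x"]]
      abs_triangle_ineq[of "F n x * e x" "G n x * h x"]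
    unfolding abs_mult by linarith
  then have 5: "AE x in lebesgue_on S. norm (F n x * e x + G n x * h x) \<le> B * \<bar>e x\<bar> + B * \<bar>h x\<bar>" for n
    by (intro AE_I2) simp
  show "integrable (lebesgue_on S) (\<lambda>x. f x * e x + g x * h x)"
    by (rule integrable_dominated_convergence[OF 1 2 3 4 5])
  show "(\<lambda>n. \<integral>x. F n x * e x + G n x * h x \<partial>lebesgue_on S) \<longlonglongrightarrow>
      (\<integral>x. f x * e x + g x * h x \<partial>lebesgue_on S)"
    by (rule integral_dominated_convergence[OF 1 2 3 4 5])
qed

lemma real_polynomial_function_antiderivative:
  fixes P :: "real \<Rightarrow> real"
  assumes "real_polynomial_function P"
  shows "\<exists>Q. real_polynomial_function Q \<and> Q 0 = k \<and> (\<forall>x. (Q has_real_derivative P x) (at x))"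
proof -
  obtain a n where P: "P = (\<lambda>x. \<Sum>i\<le>n. a i * x ^ i)"
    using assms real_polynomial_function_iff_sum by blast
  define Q where "Q = (\<lambda>x. k + (\<Sum>i\<le>n. (a i / real (Suc i)) * x ^ Suc i))"
  have "real_polynomial_function (\<lambda>x. (a i / real (Suc i)) * x ^ Suc i)" for i
    by (intro real_polynomial_function.intros real_polynomial_function_power) (simp add: bounded_linear_ident)
  then have "real_polynomial_function Q"
    unfolding Q_def
    by (intro real_polynomial_function.intros(3)[OF real_polynomial_function.intros(2)]
        real_polynomial_function_sum) auto
  moreover have "Q 0 = k" by (simp add: Q_def)
  moreover have "(Q has_real_derivative P x) (at x)" for x
  proof -
    have "((\<lambda>x. (a i / real (Suc i)) * x ^ Suc i) has_real_derivative a i * x ^ i) (at x)" for i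
      using DERIV_cmult[OF DERIV_pow[of "Suc i" x UNIV], of "a i / real (Suc i)"]
      by (simp del: of_nat_Suc power_Suc)
    then have "((\<lambda>x. \<Sum>i\<le>n. (a i / real (Suc i)) * x ^ Suc i) has_real_derivative (\<Sum>i\<le>n. a i * x ^ i)) (at x)"
      by (rule DERIV_sum)
    from DERIV_add[OF DERIV_const[of k] this] show ?thesis by (simp add: Q_def P)
  qed
  ultimately show ?thesis by blast
qed

text \<open>Approximating \<open>\<eta>'\<close> uniformly by polynomials and integrating them from the value \<open>\<eta> 0\<close>
  approximates \<open>\<eta>\<close> uniformly as well.\<close>

lemma energy_identity_C1:
  fixes e h \<eta> \<eta>' :: "real \<Rightarrow> real"
  assumes H: "H > 0"
    and e: "integrable (lebesgue_on {0<..<H}) e" and h: "integrable (lebesgue_on {0<..<H}) h"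
    and id: "\<And>q. smooth q \<Longrightarrow>
      (\<integral>x. q x * e x + frechet_derivative q (at x) 1 * h x \<partial>lebesgue_on {0<..<H}) = 0"
    and \<eta>: "\<And>x. (\<eta> has_real_derivative \<eta>' x) (at x)" and \<eta>': "continuous_on UNIV \<eta>'"
  shows "(\<integral>x. \<eta> x * e x + \<eta>' x * h x \<partial>lebesgue_on {0<..<H}) = 0"
proof -
  have "\<exists>P. real_polynomial_function P \<and> (\<forall>x\<in>{0..H}. \<bar>\<eta>' x - P x\<bar> < 1 / real (Suc n))" for n
    by (rule Stone_Weierstrass_real_polynomial_function[OF compact_Icc[of 0 H]
          continuous_on_subset[OF \<eta>' subset_UNIV], of "1 / real (Suc n)"]) (simp, blast)
  then obtain P where P: "\<And>n. real_polynomial_function (P n)"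
      "\<And>n x. x \<in> {0..H} \<Longrightarrow> \<bar>\<eta>' x - P n x\<bar> < 1 / real (Suc n)"
    by metis
  obtain Q where Q: "\<And>n. real_polynomial_function (Q n)" "\<And>n. Q n 0 = \<eta> 0"
      "\<And>n x. (Q n has_real_derivative P n x) (at x)"
    using real_polynomial_function_antiderivative[OF P(1), where k = "\<eta> 0"] by metis
  have Qle: "\<bar>\<eta> x - Q n x\<bar> \<le> H / real (Suc n)" if x: "x \<in> {0<..<H}" for n x
  proof -
    have "((\<lambda>x. \<eta> x - Q n x) has_real_derivative \<eta>' x - P n x) (at x)" for x
      by (intro DERIV_diff \<eta> Q)
    then obtain z where z: "z > 0" "z < x"
        "(\<eta> x - Q n x) - (\<eta> 0 - Q n 0) = (x - 0) * (\<eta>' z - P n z)"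
      using MVT2[of 0 x "\<lambda>x. \<eta> x - Q n x" "\<lambda>x. \<eta>' x - P n x"] x by auto
    then have "\<bar>\<eta> x - Q n x\<bar> = x * \<bar>\<eta>' z - P n z\<bar>"
      using x by (simp add: Q abs_mult)
    also have "\<dots> \<le> H * (1 / real (Suc n))"
      using x z P(2)[of z n] by (intro mult_mono) auto
    finally show ?thesis by simp
  qed
  have lim0: "(\<lambda>n. K / real (Suc n)) \<longlonglongrightarrow> 0" for K
    using tendsto_mult_left[OF LIMSEQ_Suc[OF lim_1_over_n], of K] by simp
  have c\<eta>: "continuous_on UNIV \<eta>"
    using \<eta> by (meson DERIV_isCont continuous_at_imp_continuous_on)
  obtain B1 where B1: "\<And>x. x \<in> {0..H} \<Longrightarrow> \<bar>\<eta> x\<bar> \<le> B1"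
    using bounded_on_interval[OF continuous_on_subset[OF c\<eta>]] by blast
  obtain B2 where B2: "\<And>x. x \<in> {0..H} \<Longrightarrow> \<bar>\<eta>' x\<bar> \<le> B2"
    using bounded_on_interval[OF continuous_on_subset[OF \<eta>']] by blast
  have le: "K / real (Suc n) \<le> K" if "K \<ge> 0" for K n
    using that by (simp add: divide_le_eq mult_left_le algebra_simps)
  have "(\<lambda>n. \<integral>x. Q n x * e x + P n x * h x \<partial>lebesgue_on {0<..<H}) \<longlonglongrightarrow>
      (\<integral>x. \<eta> x * e x + \<eta>' x * h x \<partial>lebesgue_on {0<..<H})"
  proof (rule weighted_integral_tendsto(2)[OF e h, where B = "max (B1 + H) (B2 + 1)"])
    show "Q n \<in> borel_measurable (lebesgue_on {0<..<H})" "P n \<in> borel_measurable (lebesgue_on {0<..<H})" for n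
      by (rule continuous_measurable_lebesgue_on[OF smooth_continuous_on[OF
            smooth_real_polynomial_function]], rule P Q)+
    show "\<bar>Q n x\<bar> \<le> max (B1 + H) (B2 + 1)" if "x \<in> {0<..<H}" for n x
      using Qle[OF that, of n] B1[of x] le[of H n] H that by auto
    show "\<bar>P n x\<bar> \<le> max (B1 + H) (B2 + 1)" if "x \<in> {0<..<H}" for n x
    proof -
      have "x \<in> {0..H}" using that by simp
      from P(2)[OF this, of n] B2[OF this] le[of 1 n] have "\<bar>P n x\<bar> \<le> B2 + 1" by linarith
      then show ?thesis by simp
    qed
    show "(\<lambda>n. Q n x) \<longlonglongrightarrow> \<eta> x" if "x \<in> {0<..<H}" for x
      by (rule LIM_zero_cancel, rule Lim_null_comparison[OF _ lim0[of H]])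
         (use Qle[OF that] in \<open>auto simp: abs_minus_commute\<close>)
    show "(\<lambda>n. P n x) \<longlonglongrightarrow> \<eta>' x" if "x \<in> {0<..<H}" for x
      by (rule LIM_zero_cancel, rule Lim_null_comparison[OF _ lim0[of 1]])
         (use P(2)[of x] that in \<open>auto simp: abs_minus_commute less_imp_le\<close>)
  qed
  moreover have "(\<integral>x. Q n x * e x + P n x * h x \<partial>lebesgue_on {0<..<H}) = 0" for n
    using id[OF smooth_real_polynomial_function[OF Q(1)], of n]
    by (simp add: frechet_derivative_real[OF Q(3)])
  ultimately show ?thesis
    using LIMSEQ_unique by (auto simp: tendsto_const_iff)
qed

text \<open>For \<open>l \<le> r\<close> the function \<open>clip\<close> is the retraction of the line onto \<open>[l,r]\<close>, written with absolute
  values so that replacing \<open>\<bar>x\<bar>\<close> by \<open>\<surd>(x\<^sup>2 + 1/n)\<close> smooths it; \<open>step\<close> is then the limit of the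
  derivatives at every point, with the value \<open>1/2\<close> at the kinks.\<close>

lemma energy_identity_clip:
  fixes e h G G' :: "real \<Rightarrow> real" and l r :: real
  assumes H: "H > 0"
    and e: "integrable (lebesgue_on {0<..<H}) e" and h: "integrable (lebesgue_on {0<..<H}) h"
    and id: "\<And>q. smooth q \<Longrightarrow>
      (\<integral>x. q x * e x + frechet_derivative q (at x) 1 * h x \<partial>lebesgue_on {0<..<H}) = 0"
    and G: "\<And>x. (G has_real_derivative G' x) (at x)" and G': "continuous_on UNIV G'"
  defines "clip \<equiv> \<lambda>y. (l + r + \<bar>y - l\<bar> - \<bar>y - r\<bar>) / 2"
  defines "step \<equiv> \<lambda>y. (sgn (y - l) - sgn (y - r)) / 2"
  shows "integrable (lebesgue_on {0<..<H}) (\<lambda>y. G (clip y) * e y + (G' (clip y) * step y) * h y)"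
    and "(\<integral>y. G (clip y) * e y + (G' (clip y) * step y) * h y \<partial>lebesgue_on {0<..<H}) = 0"
proof -
  define s where "s = (\<lambda>n z. sqrt (z\<^sup>2 + 1 / real (Suc n)))"
  define C where "C = (\<lambda>n y. (l + r + s n (y - l) - s n (y - r)) / 2)"
  define D where "D = (\<lambda>n y. ((y - l) / s n (y - l) - (y - r) / s n (y - r)) / 2)"
  have pos: "z\<^sup>2 + 1 / real (Suc n) > 0" for z n
    by (intro add_nonneg_pos) auto
  have spos: "s n z > 0" for n z using pos by (simp add: s_def del: of_nat_Suc)
  have sabs: "\<bar>z\<bar> \<le> s n z" "s n z \<le> \<bar>z\<bar> + 1" for n z
  proof -
    show "\<bar>z\<bar> \<le> s n z" unfolding s_def by (rule real_le_rsqrt) simp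
    have "1 / real (Suc n) \<le> 1" by (simp add: divide_le_eq)
    then have "sqrt (1 / real (Suc n)) \<le> 1" by (simp del: of_nat_Suc)
    moreover have "sqrt (z\<^sup>2 + 1 / real (Suc n)) \<le> sqrt (z\<^sup>2) + sqrt (1 / real (Suc n))"
      by (rule sqrt_add_le_add_sqrt) simp_all
    ultimately show "s n z \<le> \<bar>z\<bar> + 1"
      unfolding s_def real_sqrt_abs by linarith
  qed
  have s': "(s n has_real_derivative z / s n z) (at z)" for n z
    unfolding s_def using pos[of z n]
    by (auto intro!: derivative_eq_intros simp: field_simps simp del: of_nat_Suc)
  have C': "(C n has_real_derivative D n y) (at y)" for n y
  proof -
    have "((\<lambda>y. s n (y - k)) has_real_derivative (y - k) / s n (y - k)) (at y)" for k
    proof -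
      have "((\<lambda>y. y - k) has_real_derivative 1) (at y)" by (auto intro!: derivative_eq_intros)
      from DERIV_chain2[OF s' this, of n] show ?thesis by simp
    qed
    from DERIV_cdivide[OF DERIV_diff[OF DERIV_add[OF DERIV_const[of "l + r"] this[of l]] this[of r]], of 2]
    show ?thesis unfolding C_def D_def by simp
  qed
  have cs: "continuous_on A (s n)" for A n
    using s' by (meson DERIV_isCont continuous_at_imp_continuous_on)
  have cC: "continuous_on A (C n)" for A n
    using C' by (meson DERIV_isCont continuous_at_imp_continuous_on)
  have cD: "continuous_on A (D n)" for A n
    unfolding D_def using spos[of n]
    by (intro continuous_intros continuous_on_compose2[OF cs[of UNIV n]]) (auto simp: less_imp_neq[symmetric])
  have cG: "continuous_on A G" for A
    using G by (meson DERIV_isCont continuous_at_imp_continuous_on)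
  have Cb: "C n y \<in> {- (\<bar>l\<bar> + \<bar>r\<bar> + H + 1)..\<bar>l\<bar> + \<bar>r\<bar> + H + 1}" if "y \<in> {0<..<H}" for n y
    using that sabs[where n = n and z = "y - l"] sabs[where n = n and z = "y - r"] by (auto simp: C_def)
  have Db: "\<bar>D n y\<bar> \<le> 1" for n y
  proof -
    have "\<bar>z / s n z\<bar> \<le> 1" for z using sabs(1)[where n = n and z = z] spos[where n = n and z = z] by (simp add: abs_divide)
    moreover have "\<bar>(k - m) / 2\<bar> \<le> 1" if "\<bar>k\<bar> \<le> 1" "\<bar>m\<bar> \<le> 1" for k m :: real
      using that by (auto simp: abs_if split: if_splits)
    ultimately show ?thesis unfolding D_def by blast
  qed
  have slim: "(\<lambda>n. s n z) \<longlonglongrightarrow> \<bar>z\<bar>" for z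
  proof -
    have "(\<lambda>n. sqrt (z\<^sup>2 + 1 / real (Suc n))) \<longlonglongrightarrow> sqrt (z\<^sup>2 + 0)"
      by (intro tendsto_intros LIMSEQ_Suc[OF lim_1_over_n])
    then show ?thesis by (simp add: s_def)
  qed
  have dlim: "(\<lambda>n. z / s n z) \<longlonglongrightarrow> sgn z" for z
  proof (cases "z = 0")
    case False
    then have "(\<lambda>n. z / s n z) \<longlonglongrightarrow> z / \<bar>z\<bar>" by (intro tendsto_intros slim) auto
    then show ?thesis by (simp add: sgn_div_norm divide_inverse mult.commute)
  qed simp
  have Clim: "(\<lambda>n. C n y) \<longlonglongrightarrow> clip y" for y
    unfolding C_def clip_def by (intro tendsto_intros slim) auto
  have Dlim: "(\<lambda>n. D n y) \<longlonglongrightarrow> step y" for y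
    unfolding D_def step_def by (intro tendsto_intros dlim) auto
  obtain B1 where B1: "\<And>x. x \<in> {- (\<bar>l\<bar> + \<bar>r\<bar> + H + 1)..\<bar>l\<bar> + \<bar>r\<bar> + H + 1} \<Longrightarrow> \<bar>G x\<bar> \<le> B1"
    using bounded_on_interval[OF cG] by blast
  obtain B2 where B2: "\<And>x. x \<in> {- (\<bar>l\<bar> + \<bar>r\<bar> + H + 1)..\<bar>l\<bar> + \<bar>r\<bar> + H + 1} \<Longrightarrow> \<bar>G' x\<bar> \<le> B2"
    using bounded_on_interval[OF continuous_on_subset[OF G']] by blast
  have cGC: "continuous_on UNIV (\<lambda>y. G (C n y))" "continuous_on UNIV (\<lambda>y. G' (C n y) * D n y)" for n
    by (auto intro!: continuous_intros cD intro: continuous_on_compose2[OF cG cC]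
        continuous_on_compose2[OF G' cC])
  have bd: "\<bar>G (C n y)\<bar> \<le> max B1 B2" "\<bar>G' (C n y) * D n y\<bar> \<le> max B1 B2" if "y \<in> {0<..<H}" for n y
  proof -
    show "\<bar>G (C n y)\<bar> \<le> max B1 B2"
      using B1[OF Cb[OF that]] by (simp add: max.coboundedI1)
    have "\<bar>G' (C n y)\<bar> * \<bar>D n y\<bar> \<le> \<bar>G' (C n y)\<bar>"
      using Db by (simp add: mult_left_le)
    then show "\<bar>G' (C n y) * D n y\<bar> \<le> max B1 B2"
      unfolding abs_mult using B2[OF Cb[OF that, of n]] by linarith
  qed
  have "isCont G' y" for y using G' by (simp add: continuous_on_eq_continuous_at)
  then have lim: "(\<lambda>n. G (C n y)) \<longlonglongrightarrow> G (clip y)"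
      "(\<lambda>n. G' (C n y) * D n y) \<longlonglongrightarrow> G' (clip y) * step y" for y
    using isCont_tendsto_compose[OF DERIV_isCont[OF G] Clim]
      tendsto_mult[OF isCont_tendsto_compose[OF _ Clim] Dlim] by blast+
  note limit = weighted_integral_tendsto[OF e h continuous_measurable_lebesgue_on[OF cGC(1)]
      continuous_measurable_lebesgue_on[OF cGC(2)] bd lim]
  show "integrable (lebesgue_on {0<..<H}) (\<lambda>y. G (clip y) * e y + (G' (clip y) * step y) * h y)"
    by (rule limit(1))
  have "(\<integral>y. G (C n y) * e y + (G' (C n y) * D n y) * h y \<partial>lebesgue_on {0<..<H}) = 0" for n
    by (rule energy_identity_C1[OF H e h id _ cGC(2)]) (auto intro!: DERIV_chain2[OF G] C')
  with limit(2) show "(\<integral>y. G (clip y) * e y + (G' (clip y) * step y) * h y \<partial>lebesgue_on {0<..<H}) = 0"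
    by (simp add: LIMSEQ_const_iff)
qed

section \<open>Decay away from the well\<close>

text \<open>After division by \<open>e\<^sup>x\<close> the claim is \<open>x + e\<^bsup>-x\<^esup> \<le> e\<^bsup>(\<surd>2-1)x\<^esup>\<close>, whose two sides differ by only about
  seven percent near \<open>x = 2\<close>. Squaring the quadratic Taylor bound at half the argument is sharp
  enough: with \<open>1.414\<close> for \<open>\<surd>2\<close> and \<open>e\<^bsup>-x\<^esup> \<le> 1/(1 + x + x\<^sup>2/2)\<close> a polynomial inequality
  remains.\<close>

lemma exp_weight_bound:
  fixes x :: real
  assumes x: "x > 0"
  shows "x * exp x \<le> exp (sqrt 2 * x) - 1"
proof -
  have s2: "1.414 \<le> sqrt 2" by (rule real_le_rsqrt) (simp add: power2_eq_square)
  have quad: "1 + z + z\<^sup>2 / 2 \<le> exp z" if "z \<ge> 0" for z :: real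
    using exp_lower_Taylor_quadratic[OF that] .
  define E where "E = 1 + x + x\<^sup>2 / 2"
  \<comment> \<open>the square of the quadratic Taylor polynomial at \<open>0.207 x\<close>, half of \<open>0.414 x\<close>\<close>
  define A where "A = (1 + 0.207 * x + 0.0214245 * x\<^sup>2)\<^sup>2"
  have E: "E > 0" "E \<le> exp x" using quad[of x] x by (auto simp: E_def intro!: add_pos_nonneg)
  have "0 \<le> (0.000792868 * x\<^sup>2 - 0.00039 * x + 0.0082)"
  proof -
    have "0.000792868 * x\<^sup>2 - 0.00039 * x + 0.0082 = 0.000792868 * (x - 0.25)\<^sup>2 + 0.000006434 * x + (0.0082 - 0.00004955425)"
      by (simp add: power2_eq_square field_simps)
    then show ?thesis using x by simp
  qed
  \<comment> \<open>The cubic \<open>(x - 2.5)\<^sup>2 (x + 1.25) = x\<^sup>3 - 3.75 x\<^sup>2 + 7.8125\<close> is the tangent bound of \<open>x\<^sup>3\<close> that absorbs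
    nearly all of the negative quadratic term.\<close>
  moreover have "0 \<le> 0.0517187 * ((x - 2.5)\<^sup>2 * (x + 1.25))" "0 \<le> 0.0044 * (x\<^sup>2 - 0.6)\<^sup>2"
    using x by simp_all
  moreover have "0.414 - 0.000302 * x - 0.198432257 * x\<^sup>2 + 0.0517187 * x ^ 3 + 0.0044 * x ^ 4 =
      (0.000792868 * x\<^sup>2 - 0.00039 * x + 0.0082) + 0.0517187 * ((x - 2.5)\<^sup>2 * (x + 1.25))
      + 0.0044 * (x\<^sup>2 - 0.6)\<^sup>2 + (0.000088 * x + 0.00016365625)"
    by (simp add: power2_eq_square power3_eq_cube power4_eq_xxxx field_simps)
  moreover have "0 \<le> 0.000088 * x + 0.00016365625" using x by simp
  ultimately have "0 \<le> 0.414 - 0.000302 * x - 0.198432257 * x\<^sup>2 + 0.0517187 * x ^ 3 + 0.0044 * x ^ 4"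
    by (simp only: add_nonneg_nonneg)
  then have "0 \<le> x * (0.414 - 0.000302 * x - 0.198432257 * x\<^sup>2 + 0.0517187 * x ^ 3 + 0.0044 * x ^ 4)"
    using x by simp
  moreover have "(A - x) * E - 1 =
      x * (0.414 - 0.000302 * x - 0.198432257 * x\<^sup>2 + 0.0517187 * x ^ 3 + 0.0044 * x ^ 4)
      + (0.00045905220025 * x ^ 4 + 0.00049388070025 * x ^ 5 + 0.000229504600125 * x ^ 6)"
    unfolding A_def E_def
    by (simp add: power2_eq_square power3_eq_cube power4_eq_xxxx numeral_eq_Suc field_simps)
  moreover have "0 \<le> 0.00045905220025 * x ^ 4 + 0.00049388070025 * x ^ 5 + 0.000229504600125 * x ^ 6"
    using x by simp
  ultimately have "0 \<le> (A - x) * E - 1"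
    by (simp only: add_nonneg_nonneg)
  then have "x + 1 / E \<le> A" using E by (simp add: field_simps)
  also have "A \<le> (exp (0.207 * x))\<^sup>2"
    unfolding A_def using quad[of "0.207 * x"] x
    by (intro power_mono) (auto simp: power2_eq_square algebra_simps)
  also have "\<dots> = exp (0.414 * x)" by (simp add: exp_double[symmetric])
  also have "\<dots> \<le> exp ((sqrt 2 - 1) * x)" using s2 x by simp
  finally have "x + 1 / E \<le> exp ((sqrt 2 - 1) * x)" .
  moreover have "exp (- x) \<le> 1 / E" using E by (simp add: exp_minus divide_simps)
  ultimately have "x + exp (- x) \<le> exp ((sqrt 2 - 1) * x)" by linarith
  then have "(x + exp (- x)) * exp x \<le> exp ((sqrt 2 - 1) * x) * exp x" by (intro mult_right_mono) auto
  then show ?thesis by (simp add: exp_add[symmetric] algebra_simps flip: exp_add)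
qed

text \<open>Completing the square in \<open>g\<close>.\<close>

lemma quadratic_form_bound:
  fixes u g p \<eta> \<tau> :: real
  assumes "p > 0" "\<eta> > 0"
  shows "p\<^sup>2 * (\<eta> - \<tau>\<^sup>2 / \<eta>) * u\<^sup>2 \<le> \<eta> * (g\<^sup>2 + p\<^sup>2 * u\<^sup>2) + 2 * p * \<tau> * (u * g)"
proof -
  have "\<eta> * (g\<^sup>2 + p\<^sup>2 * u\<^sup>2) + 2 * p * \<tau> * (u * g) - p\<^sup>2 * (\<eta> - \<tau>\<^sup>2 / \<eta>) * u\<^sup>2
      = \<eta> * (g + p * \<tau> * u / \<eta>)\<^sup>2"
    using assms by (simp add: power2_eq_square field_simps)
  moreover have "\<dots> \<ge> 0" using assms by simp
  ultimately show ?thesis by linarith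
qed

lemma integral_subinterval:
  fixes f :: "real \<Rightarrow> real"
  assumes "{a<..<b} \<subseteq> S" "S \<in> sets lebesgue"
  shows "(\<integral>x. indicator {a<..<b} x * f x \<partial>lebesgue_on S) = (\<integral>x. f x \<partial>lebesgue_on {a<..<b})"
proof -
  have "(\<lambda>x. indicator S x *\<^sub>R (indicator {a<..<b} x * f x)) = (\<lambda>x. indicator {a<..<b} x *\<^sub>R f x)"
    using assms(1) by (auto simp: indicator_def fun_eq_iff)
  then show ?thesis using assms(2) by (simp add: integral_restrict_space)
qed

text \<open>The sign \<open>s\<close> says on which side of the well \<open>(a,b)\<close> lies; \<open>[l,r]\<close> is the gap between them and \<open>z\<close>
  its end point at the well. The estimate integrates a pointwise lower bound for the integrand of
  the energy identity with weight \<open>2 exp(2ps(clip y - z)) - 1\<close>, from which \<open>2ps u g\<close>, of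
  integral \<open>0\<close>, has been subtracted. This subtraction lets the weight \<open>\<eta>\<close> grow at the rate
  \<open>2p(\<eta> + 1)\<close> instead of \<open>2p\<eta>\<close>, and the factor \<open>2\<close> so gained makes up for the
  denominator of \<open>p\<^sup>2 = \<xi>\<^sup>2/2\<close>.\<close>

lemma decay_from_energy_identity:
  fixes u g q :: "real \<Rightarrow> real" and l r z s p Q \<delta> :: real
  defines "clip \<equiv> \<lambda>y. (l + r + \<bar>y - l\<bar> - \<bar>y - r\<bar>) / 2"
  assumes H: "H > 0" and p: "p > 0" and Q: "Q \<ge> 0"
    and u: "u \<in> L2 {0<..<H}" and g: "g \<in> L2 {0<..<H}"
    and qu: "integrable (lebesgue_on {0<..<H}) (\<lambda>x. q x * (u x)\<^sup>2)"
    and ug: "(\<integral>x. u x * g x \<partial>lebesgue_on {0<..<H}) = 0"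
    and id: "\<And>\<eta>. smooth \<eta> \<Longrightarrow>
      (\<integral>x. \<eta> x * ((g x)\<^sup>2 + p\<^sup>2 * (u x)\<^sup>2 - q x * (u x)\<^sup>2)
        + frechet_derivative \<eta> (at x) 1 * (u x * g x) \<partial>lebesgue_on {0<..<H}) = 0"
    and q: "AE y in lebesgue_on {0<..<H}. q y \<le> (if y \<in> {\<alpha><..<\<beta>} then Q else 0)"
    and \<alpha>\<beta>: "{\<alpha><..<\<beta>} \<subseteq> {0<..<H}" and ab: "{a<..<b} \<subseteq> {0<..<H}"
    and disj: "{a<..<b} \<inter> {\<alpha><..<\<beta>} = {}"
    and s: "s = 1 \<or> s = - 1" and lr: "l \<le> r"
    and dist: "\<And>y. 0 \<le> s * (clip y - z)"
    and well: "\<And>y. y \<in> {\<alpha><..<\<beta>} \<Longrightarrow> clip y = z"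
    and far: "\<And>y. y \<in> {a<..<b} \<Longrightarrow> y \<notin> {l..r} \<and> s * (clip y - z) = \<delta>"
  defines "N \<equiv> 2 * exp (2 * p * \<delta>) - 1"
  shows "p\<^sup>2 * (N - 1 / N) * (\<integral>y. (u y)\<^sup>2 \<partial>lebesgue_on {a<..<b}) \<le>
    Q * (\<integral>y. (u y)\<^sup>2 \<partial>lebesgue_on {\<alpha><..<\<beta>})"
proof -
  let ?M = "lebesgue_on {0<..<H}"
  define step where "step = (\<lambda>y. (sgn (y - l) - sgn (y - r)) / 2)"
  define G where "G = (\<lambda>x. 2 * exp (2 * p * s * (x - z)) - 1)"
  define G' where "G' = (\<lambda>x. 2 * p * s * (G x + 1))"
  define e where "e = (\<lambda>x. (g x)\<^sup>2 + p\<^sup>2 * (u x)\<^sup>2 - q x * (u x)\<^sup>2)"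
  define h where "h = (\<lambda>x. u x * g x)"
  have ih: "integrable ?M h" unfolding h_def by (rule L2_integrable_mult[OF u g])
  have ie: "integrable ?M e" unfolding e_def
    using L2_integrable[OF u] L2_integrable[OF g] qu by auto
  have id': "(\<integral>x. \<eta> x * e x + frechet_derivative \<eta> (at x) 1 * h x \<partial>?M) = 0" if "smooth \<eta>" for \<eta>
    using id[OF that] by (simp add: e_def h_def)
  have G': "(G has_real_derivative G' x) (at x)" for x
    unfolding G_def G'_def by (auto intro!: derivative_eq_intros)
  have cG': "continuous_on UNIV G'" unfolding G_def G'_def by (intro continuous_intros)
  have weighted: "integrable ?M (\<lambda>y. G (clip y) * e y + (G' (clip y) * step y) * h y)"
      "(\<integral>y. G (clip y) * e y + (G' (clip y) * step y) * h y \<partial>?M) = 0"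
    unfolding clip_def step_def
    by (rule energy_identity_clip(1)[OF H ie ih id' G' cG'], assumption)
       (rule energy_identity_clip(2)[OF H ie ih id' G' cG'], assumption)
  have G1: "G (clip y) \<ge> 1" for y
  proof -
    have "2 * p * s * (clip y - z) \<ge> 0"
      using dist[of y] p by (simp add: mult.assoc)
    then show ?thesis by (simp add: G_def)
  qed
  have step01: "0 \<le> step y" "step y \<le> 1" for y
    using lr by (auto simp: step_def sgn_if)
  have point: "indicator {a<..<b} y * (p\<^sup>2 * (N - 1 / N) * (u y)\<^sup>2) - indicator {\<alpha><..<\<beta>} y * (Q * (u y)\<^sup>2)
      \<le> G (clip y) * e y + (G' (clip y) * step y) * h y - 2 * p * s * h y"
    if y: "q y \<le> (if y \<in> {\<alpha><..<\<beta>} then Q else 0)" for y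
  proof -
    define \<eta> where "\<eta> = G (clip y)"
    \<comment> \<open>\<open>2p\<tau>\<close> is the coefficient of \<open>u g\<close>; the weight is chosen so that \<open>\<bar>\<tau>\<bar> \<le> \<eta>\<close>, for every
      value of \<open>step\<close> in \<open>[0,1]\<close>\<close>
    define \<tau> where "\<tau> = s * (step y * (\<eta> + 1) - 1)"
    have \<eta>: "\<eta> \<ge> 1" using G1 by (simp add: \<eta>_def)
    have "0 \<le> step y * (\<eta> + 1)" "step y * (\<eta> + 1) \<le> 1 * (\<eta> + 1)"
      using step01[of y] \<eta> by (auto intro!: mult_right_mono simp del: mult_1)
    moreover have "\<bar>t - 1\<bar> \<le> \<eta>" if "0 \<le> t" "t \<le> 1 * (\<eta> + 1)" for t
      using that \<eta> by auto
    ultimately have "\<bar>step y * (\<eta> + 1) - 1\<bar> \<le> \<eta>" by blast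
    then have "(step y * (\<eta> + 1) - 1)\<^sup>2 \<le> \<eta>\<^sup>2"
      using \<eta> by (intro abs_le_square_iff[THEN iffD1]) simp
    then have "\<tau>\<^sup>2 \<le> \<eta>\<^sup>2"
      using s by (auto simp: \<tau>_def power_mult_distrib power2_commute[of 1])
    then have \<tau>: "0 \<le> \<eta> - \<tau>\<^sup>2 / \<eta>"
      using \<eta> by (simp add: field_simps power2_eq_square)
    have expand: "G (clip y) * e y + (G' (clip y) * step y) * h y - 2 * p * s * h y =
        \<eta> * ((g y)\<^sup>2 + p\<^sup>2 * (u y)\<^sup>2) + 2 * p * \<tau> * (u y * g y) - \<eta> * (q y * (u y)\<^sup>2)"
      by (simp add: e_def h_def G'_def \<eta>_def \<tau>_def algebra_simps)
    have low: "p\<^sup>2 * (\<eta> - \<tau>\<^sup>2 / \<eta>) * (u y)\<^sup>2 \<le> \<eta> * ((g y)\<^sup>2 + p\<^sup>2 * (u y)\<^sup>2) + 2 * p * \<tau> * (u y * g y)"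
      using p \<eta> by (intro quadratic_form_bound) auto
    have low0: "0 \<le> p\<^sup>2 * (\<eta> - \<tau>\<^sup>2 / \<eta>) * (u y)\<^sup>2" using \<tau> by simp
    consider "y \<in> {\<alpha><..<\<beta>}" | "y \<in> {a<..<b}" "y \<notin> {\<alpha><..<\<beta>}" | "y \<notin> {a<..<b}" "y \<notin> {\<alpha><..<\<beta>}" by blast
    then show ?thesis
    proof cases
      case 1
      then have "\<eta> = 1" using well by (simp add: \<eta>_def G_def)
      moreover have "y \<notin> {a<..<b}" using 1 disj by blast
      moreover have "q y * (u y)\<^sup>2 \<le> Q * (u y)\<^sup>2" using y 1 by (intro mult_right_mono) auto
      ultimately show ?thesis using 1 low low0 unfolding expand by simp
    next
      case 2
      have "\<eta> = N" using far[OF 2(1)] by (simp add: \<eta>_def G_def N_def mult.assoc)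
      moreover have "step y = 0" using far[OF 2(1)] lr by (auto simp: step_def sgn_if)
      then have "\<tau>\<^sup>2 = 1" using s by (auto simp: \<tau>_def)
      moreover have "\<eta> * (q y * (u y)\<^sup>2) \<le> 0"
        using y 2(2) \<eta> by (intro mult_nonneg_nonpos mult_nonpos_nonneg) (auto split: if_splits)
      ultimately show ?thesis using 2 low unfolding expand by simp
    next
      case 3
      have "\<eta> * (q y * (u y)\<^sup>2) \<le> 0"
        using y 3(2) \<eta> by (intro mult_nonneg_nonpos mult_nonpos_nonneg) (auto split: if_splits)
      then show ?thesis using 3 low low0 unfolding expand by simp
    qed
  qed
  have iu: "integrable ?M (\<lambda>y. indicator A y * (k * (u y)\<^sup>2))" if "A = {c<..<d}" for A c d k
  proof -
    have "A \<inter> {0<..<H} \<in> sets ?M"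
      using that by (auto simp: sets_restrict_space)
    from integrable_mult_indicator[OF this integrable_mult_right[OF L2_integrable[OF u], of k]]
    show ?thesis
      by (rule Bochner_Integration.integrable_cong[THEN iffD1, rotated 2]) (auto simp: indicator_def)
  qed
  have "p\<^sup>2 * (N - 1 / N) * (\<integral>y. (u y)\<^sup>2 \<partial>lebesgue_on {a<..<b}) - Q * (\<integral>y. (u y)\<^sup>2 \<partial>lebesgue_on {\<alpha><..<\<beta>})
      = (\<integral>y. indicator {a<..<b} y * (p\<^sup>2 * (N - 1 / N) * (u y)\<^sup>2) - indicator {\<alpha><..<\<beta>} y * (Q * (u y)\<^sup>2) \<partial>?M)"
    using integral_subinterval[OF ab, of "\<lambda>y. p\<^sup>2 * (N - 1 / N) * (u y)\<^sup>2"]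
      integral_subinterval[OF \<alpha>\<beta>, of "\<lambda>y. Q * (u y)\<^sup>2"]
    by (subst Bochner_Integration.integral_diff) (auto intro: iu)
  also have "\<dots> \<le> (\<integral>y. (G (clip y) * e y + (G' (clip y) * step y) * h y) - 2 * p * s * h y \<partial>?M)"
    using q point ih weighted(1) by (intro integral_mono_AE) (auto intro!: iu)
  also have "\<dots> = 0"
    using weighted ug ih by (simp add: h_def)
  finally show ?thesis by simp
qed

section \<open>Essential bounds\<close>

text \<open>The real number \<open>ess_sup\<close> is a bound only if the extended real supremum is finite: the bounds
  \<open>A\<close> and \<open>B\<close> and the positive measure exclude the values \<open>\<plusminus>\<infinity>\<close>, which are sent to \<open>0\<close>.\<close>

lemma ess_sup_bounds:
  fixes f :: "'a::euclidean_space \<Rightarrow> real"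
  assumes f: "f \<in> borel_measurable (lebesgue_on S)"
    and S: "emeasure lebesgue S \<noteq> 0" "S \<in> sets lebesgue"
    and A: "AE x in lebesgue_on S. A \<le> f x" and B: "AE x in lebesgue_on S. f x \<le> B"
  shows "A \<le> ess_sup S f" and "AE x in lebesgue_on S. f x \<le> ess_sup S f"
proof -
  let ?s = "esssup (lebesgue_on S) (\<lambda>x. ereal (f x))"
  have m: "(\<lambda>x. ereal (f x)) \<in> borel_measurable (lebesgue_on S)" using f by simp
  have le: "?s \<le> ereal B" using B by (intro esssup_I[OF m]) simp
  have "ereal A = esssup (lebesgue_on S) (\<lambda>x. ereal A)"
    by (rule esssup_const[symmetric]) (use S in \<open>simp add: emeasure_restrict_space\<close>)
  also have "\<dots> \<le> ?s" using A by (intro esssup_AE_mono) auto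
  finally have ge: "ereal A \<le> ?s" .
  obtain r where r: "?s = ereal r" using le ge by (cases ?s) auto
  show "A \<le> ess_sup S f" using ge r by (simp add: ess_sup_def)
  show "AE x in lebesgue_on S. f x \<le> ess_sup S f"
    using esssup_AE[of "\<lambda>x. ereal (f x)" "lebesgue_on S"] r by (simp add: ess_sup_def)
qed

lemma Linf_bounded:
  assumes "f \<in> Linf S"
  obtains B where "AE x in lebesgue_on S. \<bar>f x\<bar> \<le> B"
proof -
  let ?s = "esssup (lebesgue_on S) (\<lambda>x. ereal \<bar>f x\<bar>)"
  have ae: "AE x in lebesgue_on S. ereal \<bar>f x\<bar> \<le> ?s" by (rule esssup_AE)
  have "?s < \<infinity>" using assms by (simp add: Linf_def)
  then consider r where "?s = ereal r" | "?s = - \<infinity>" by (cases ?s) auto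
  then show thesis
  proof cases
    case 1
    then show thesis using ae by (intro that[of r]) simp
  next
    case 2
    then show thesis using ae by (intro that[of 0]) (auto elim: eventually_mono)
  qed
qed

lemma ess_inf_le:
  assumes f: "f \<in> Linf S" and S: "emeasure lebesgue S \<noteq> 0" "S \<in> sets lebesgue"
  shows "AE x in lebesgue_on S. ess_inf S f \<le> f x"
proof -
  obtain B where B: "AE x in lebesgue_on S. \<bar>f x\<bar> \<le> B" using Linf_bounded[OF f] by blast
  have "AE x in lebesgue_on S. - f x \<le> ess_sup S (\<lambda>x. - f x)"
  proof (rule ess_sup_bounds(2)[OF _ S])
    show "(\<lambda>x. - f x) \<in> borel_measurable (lebesgue_on S)" using f by (simp add: Linf_def)
    show "AE x in lebesgue_on S. - B \<le> - f x" using B by eventually_elim simp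
    show "AE x in lebesgue_on S. - f x \<le> B" using B by eventually_elim simp
  qed
  then show ?thesis by eventually_elim (simp add: ess_inf_def)
qed

lemma AE_lebesgue_on_subset:
  assumes "AE x in lebesgue_on S. P x" "T \<subseteq> S" "S \<in> sets lebesgue" "T \<in> sets lebesgue"
  shows "AE x in lebesgue_on T. P x"
proof -
  have "AE x in lebesgue. x \<in> S \<longrightarrow> P x"
    using assms by (simp add: AE_restrict_space_iff)
  then have "AE x in lebesgue. x \<in> T \<longrightarrow> P x"
    by eventually_elim (use assms(2) in auto)
  then show ?thesis using assms by (simp add: AE_restrict_space_iff)
qed

lemma L2_subset:
  assumes f: "f \<in> L2 S" and T: "T \<subseteq> S" "T \<in> sets lebesgue" "S \<in> sets lebesgue"
  shows "f \<in> L2 T"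
proof -
  have m: "f \<in> borel_measurable (lebesgue_on T)"
    using measurable_restrict_mono[of f "lebesgue" S borel T] L2_measurable[OF f] T(1) by simp
  have "T \<in> sets (lebesgue_on S)" using T by (simp add: sets_restrict_space_iff)
  from integrable_mult_indicator[OF this L2_integrable[OF f]]
  have "integrable lebesgue (\<lambda>x. indicator S x *\<^sub>R indicator T x *\<^sub>R (f x)\<^sup>2)"
    using T by (simp add: integrable_restrict_space)
  moreover have "(\<lambda>x. indicator S x *\<^sub>R indicator T x *\<^sub>R (f x)\<^sup>2) = (\<lambda>x. indicator T x *\<^sub>R (f x)\<^sup>2)"
    using T(1) by (auto simp: indicator_def fun_eq_iff)
  ultimately show ?thesis
    using m T by (simp add: L2_iff integrable_restrict_space)
qed

lemma integral_subset_mono: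
  fixes f h :: "'a::euclidean_space \<Rightarrow> real"
  assumes T: "T \<subseteq> S" "T \<in> sets lebesgue" "S \<in> sets lebesgue"
    and f: "integrable (lebesgue_on T) f" and h: "integrable (lebesgue_on S) h"
    and le: "AE x in lebesgue_on S. f x \<le> h x" and pos: "AE x in lebesgue_on S. 0 \<le> h x"
  shows "(\<integral>x. f x \<partial>lebesgue_on T) \<le> (\<integral>x. h x \<partial>lebesgue_on S)"
proof -
  have "(\<integral>x. indicator T x *\<^sub>R f x \<partial>lebesgue) \<le> (\<integral>x. indicator S x *\<^sub>R h x \<partial>lebesgue)"
  proof (rule integral_mono_AE)
    have "AE x in lebesgue. x \<in> S \<longrightarrow> f x \<le> h x" "AE x in lebesgue. x \<in> S \<longrightarrow> 0 \<le> h x"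
      using le pos T by (simp_all add: AE_restrict_space_iff)
    then show "AE x in lebesgue. indicator T x *\<^sub>R f x \<le> indicator S x *\<^sub>R h x"
      by eventually_elim (use T(1) in \<open>auto simp: indicator_def\<close>)
  qed (use f h T in \<open>simp_all add: integrable_restrict_space\<close>)
  then show ?thesis using T by (simp add: integral_restrict_space)
qed

section \<open>Separation of variables\<close>

text \<open>The Laplacian of \<open>\<phi> \<otimes> u\<close> is \<open>\<Delta>\<phi> \<otimes> u + \<phi> \<otimes> u'' = \<phi> \<otimes> (u'' - m\<^sup>2 u)\<close>, and \<open>c\<close> depends on the last
  coordinate only.\<close>

lemma op_A_tensor:
  fixes S :: "'a::euclidean_space set"
  assumes S: "S \<in> sets lebesgue"
    and \<phi>: "(\<phi>, \<lambda>x. m\<^sup>2 * \<phi> x) \<in> op_A S (\<lambda>_. 1)"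
    and u: "(u, \<lambda>y. lam * u y) \<in> op_Ak H c m"
  shows "(tensor \<phi> u, \<lambda>z. lam * tensor \<phi> u z) \<in> op_A (S \<times> {0<..<H}) (\<lambda>z. c (snd z))"
proof -
  let ?T = "{0<..<H}"
  interpret real_lebesgue_product S ?T
    by (intro real_lebesgue_product.intro lebesgue_product.intro S) simp
  obtain D E where DE: "\<And>b. b \<in> Basis \<Longrightarrow> weak_deriv S b \<phi> (D b) \<and> weak_deriv S b (D b) (E b)"
      and E: "AE x in lebesgue_on S. m\<^sup>2 * \<phi> x = - (\<Sum>b\<in>Basis. E b x)"
  proof -
    obtain l where l: "weak_laplacian S \<phi> l" "AE x in lebesgue_on S. m\<^sup>2 * \<phi> x = - 1 * l x"
      using \<phi> by (auto simp: op_A_def)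
    then obtain D E where "\<forall>b\<in>Basis. weak_deriv S b \<phi> (D b) \<and> weak_deriv S b (D b) (E b)"
        "AE x in lebesgue_on S. l x = (\<Sum>b\<in>Basis. E b x)"
      unfolding weak_laplacian_def by blast
    moreover from this(2) l(2) have "AE x in lebesgue_on S. m\<^sup>2 * \<phi> x = - (\<Sum>b\<in>Basis. E b x)"
      by eventually_elim simp
    ultimately show thesis using that by blast
  qed
  obtain u' u'' where u': "weak_deriv ?T 1 u u'" "weak_deriv ?T 1 u' u''"
      and u'': "AE y in lebesgue_on ?T. lam * u y = c y * (m\<^sup>2 * u y - u'' y)"
    using u by (auto simp: op_Ak_def)
  have L: "\<phi> \<in> L2 S" "u \<in> L2 ?T"
    using \<phi> u by (auto simp: op_A_def op_Ak_def H2_def H1_def)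
  define D' where "D' = (\<lambda>b :: 'a \<times> real. if snd b = 0 then tensor (D (fst b)) u else tensor \<phi> u')"
  define E' where "E' = (\<lambda>b :: 'a \<times> real. if snd b = 0 then tensor (E (fst b)) u else tensor \<phi> u'')"
  define l where "l = (\<lambda>z. \<Sum>b\<in>Basis. E' b z)"
  have sum: "l z = (\<Sum>b\<in>Basis. E b (fst z)) * u (snd z) + \<phi> (fst z) * u'' (snd z)" for z
  proof -
    have "l z = (\<Sum>b\<in>(\<lambda>b. (b, 0)) ` Basis. E' b z) + (\<Sum>b\<in>Pair 0 ` Basis. E' b z)"
      unfolding l_def Basis_prod_def by (rule sum.union_disjoint) (auto simp: nonzero_Basis)
    also have "\<dots> = (\<Sum>b\<in>Basis. E' (b, 0) z) + E' (0, 1) z"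
      by (subst sum.reindex) (auto simp: inj_on_def)
    finally show ?thesis by (simp add: E'_def tensor_apply sum_distrib_right)
  qed
  have "weak_deriv (S \<times> ?T) b (tensor \<phi> u) (D' b) \<and> weak_deriv (S \<times> ?T) b (D' b) (E' b)"
    if b: "b \<in> Basis" for b
  proof -
    consider i where "b = (i, 0)" "i \<in> Basis" | "b = (0, 1)"
      using b by (auto simp: Basis_prod_def)
    then show ?thesis
      by cases (auto simp: D'_def E'_def DE L u' weak_deriv_tensor_fst weak_deriv_tensor_snd)
  qed
  then have lap: "weak_laplacian (S \<times> ?T) (tensor \<phi> u) l"
    unfolding weak_laplacian_def l_def by blast
  have ae: "AE z in lebesgue_on (S \<times> ?T). lam * tensor \<phi> u z = - c (snd z) * l z"
    using AE_fst[OF E] AE_snd[OF u'']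
  proof eventually_elim
    case (elim z)
    have "- c (snd z) * l z = \<phi> (fst z) * (c (snd z) * (m\<^sup>2 * u (snd z) - u'' (snd z)))"
    proof -
      have "(\<Sum>b\<in>Basis. E b (fst z)) = - (m\<^sup>2 * \<phi> (fst z))" using elim(1) by linarith
      then show ?thesis by (simp add: sum algebra_simps)
    qed
    then show ?case using elim(2) by (simp add: tensor_apply)
  qed
  have w: "tensor \<phi> u \<in> L2w (S \<times> ?T) (\<lambda>z. 1 / c (snd z))"
    using L2w_tensor[OF L(1), of u "\<lambda>y. 1 / c y"] u by (auto simp: op_Ak_def)
  moreover from this have "(\<lambda>z. lam * tensor \<phi> u z) \<in> L2w (S \<times> ?T) (\<lambda>z. 1 / c (snd z))"
    by (auto simp: L2w_def power_mult_distrib mult.assoc simp del: times_divide_eq_right)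
  ultimately show ?thesis
    using H2_tensor[of \<phi> u] H10_tensor[of \<phi> u] \<phi> u lap ae by (auto simp: op_A_def op_Ak_def)
qed

lemma eigenfunction_tensor:
  fixes S :: "'a::euclidean_space set"
  assumes S: "S \<in> sets lebesgue"
    and \<phi>: "eigenfunction S (op_A S (\<lambda>_. 1)) (m\<^sup>2) \<phi>" and \<phi>1: "(\<integral>x. \<phi> x * \<phi> x \<partial>lebesgue_on S) = 1"
    and u: "eigenfunction {0<..<H} (op_Ak H c m) lam u"
  shows "eigenfunction (S \<times> {0<..<H}) (op_A (S \<times> {0<..<H}) (\<lambda>z. c (snd z))) lam (tensor \<phi> u)"
proof -
  let ?T = "{0<..<H}"
  interpret real_lebesgue_product S ?T
    by (intro real_lebesgue_product.intro lebesgue_product.intro S) simp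
  have L: "\<phi> \<in> L2 S" "u \<in> L2 ?T"
    using \<phi> u by (auto simp: eigenfunction_def op_A_def op_Ak_def H2_def H1_def)
  have "\<not> (AE z in lebesgue_on (S \<times> ?T). tensor \<phi> u z = 0)"
  proof
    assume "AE z in lebesgue_on (S \<times> ?T). tensor \<phi> u z = 0"
    then have "(\<integral>z. (tensor \<phi> u z)\<^sup>2 \<partial>lebesgue_on (S \<times> ?T)) = 0"
      by (intro integral_eq_zero_AE) simp
    then have "(\<integral>y. (u y)\<^sup>2 \<partial>lebesgue_on ?T) = 0"
      using \<phi>1 unfolding integral_tensor_square[OF L] by (simp add: power2_eq_square)
    then have "AE y in lebesgue_on ?T. (u y)\<^sup>2 = 0"
      using L2_integrable[OF L(2)] by (subst (asm) integral_nonneg_eq_0_iff_AE) auto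
    then show False using u by (simp add: eigenfunction_def)
  qed
  moreover have "(tensor \<phi> u, \<lambda>z. lam * tensor \<phi> u z) \<in> op_A (S \<times> ?T) (\<lambda>z. c (snd z))"
    using \<phi> u by (intro op_A_tensor[OF S, of \<phi> m]) (auto simp: eigenfunction_def)
  ultimately show ?thesis by (simp add: eigenfunction_def)
qed

lemma layer_integral_tensor_square:
  fixes S :: "'a::euclidean_space set"
  assumes S: "S \<in> sets lebesgue" and \<phi>: "\<phi> \<in> L2 S" "(\<integral>x. \<phi> x * \<phi> x \<partial>lebesgue_on S) = 1"
    and u: "u \<in> L2 {0<..<H}" and ab: "{a<..<b} \<subseteq> {0<..<H}"
  shows "(\<integral>z. (tensor \<phi> u z)\<^sup>2 \<partial>lebesgue_on (layer S a b)) = (\<integral>y. (u y)\<^sup>2 \<partial>lebesgue_on {a<..<b})"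
proof -
  interpret real_lebesgue_product S "{a<..<b}"
    by (intro real_lebesgue_product.intro lebesgue_product.intro S) simp
  have "u \<in> L2 {a<..<b}" using L2_subset[OF u ab] by simp
  from integral_tensor_square[OF \<phi>(1) this] show ?thesis
    using \<phi>(2) by (simp add: layer_def power2_eq_square)
qed

section \<open>The decay estimate\<close>

text \<open>Testing with the weight \<open>1\<close> shows \<open>\<lambda> \<ge> 0\<close>, which is what makes the sign of
  \<open>q = \<lambda>(1/c - 1/c\<^sub>1)\<close> follow that of \<open>c\<^sub>1 - c\<close>.\<close>

lemma well_decay:
  fixes u c :: "real \<Rightarrow> real"
  assumes H: "H > 0" and c: "c \<in> Linf {0<..<H}" and cm: "0 < ess_inf {0<..<H} c"
    and \<alpha>\<beta>: "0 \<le> \<alpha>" "\<alpha> < \<beta>" "\<beta> \<le> H" and ab: "0 \<le> a" "a < b" "b \<le> H"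
    and well: "is_well H c \<alpha> \<beta> c1"
    and u: "(u, \<lambda>y. lam * u y) \<in> op_Ak H c m"
    and norm: "(\<integral>y. (u y)\<^sup>2 / c y \<partial>lebesgue_on {0<..<H}) = 1"
    and \<xi>: "\<xi> > 0" "\<xi>\<^sup>2 = 2 * (m\<^sup>2 - lam / c1)"
    and d: "d > 0" "d = a - \<beta> \<or> d = \<alpha> - b" and t: "0 < t" "t < 1"
  defines "K \<equiv> ess_sup {\<alpha><..<\<beta>} (\<lambda>y. \<bar>(c1 - c y) / (c1 * c y)\<bar>)"
  shows "lam \<ge> 0" and "K \<ge> 0"
    and "(\<integral>y. (u y)\<^sup>2 \<partial>lebesgue_on {a<..<b}) \<le>
      K * (lam / \<xi> ^ 3) * (exp (- \<xi> * (1 - t) * d) / ((1 - t) * d))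
        * (\<integral>y. (u y)\<^sup>2 \<partial>lebesgue_on {\<alpha><..<\<beta>})"
proof -
  let ?I = "{0<..<H}" and ?M = "lebesgue_on {0<..<H}"
  let ?k = "\<lambda>y. \<bar>(c1 - c y) / (c1 * c y)\<bar>"
  define p where "p = \<xi> / sqrt 2"
  have p: "p > 0" "p\<^sup>2 = m\<^sup>2 - lam / c1" using \<xi> by (simp_all add: p_def power_divide)
  have subW: "{\<alpha><..<\<beta>} \<subseteq> ?I" and subF: "{a<..<b} \<subseteq> ?I" using \<alpha>\<beta> ab by auto
  have c1: "c1 > 0" using well cm by (simp add: is_well_def)
  have cpos: "AE y in ?M. ess_inf ?I c \<le> c y"
    by (rule ess_inf_le[OF c]) (use H in auto)
  obtain B where B: "AE y in ?M. \<bar>c y\<bar> \<le> B" using Linf_bounded[OF c] by blast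
  have cW: "AE y in lebesgue_on {\<alpha><..<\<beta>}. ess_inf ?I c \<le> c y \<and> \<bar>c y\<bar> \<le> B"
    using AE_lebesgue_on_subset[OF AE_conjI[OF cpos B] subW] by simp
  have cmeas: "c \<in> borel_measurable ?M" using c by (simp add: Linf_def)
  have cmeasW: "c \<in> borel_measurable (lebesgue_on {\<alpha><..<\<beta>})"
    using measurable_restrict_mono[of c lebesgue ?I borel "{\<alpha><..<\<beta>}"] cmeas subW by simp
  have K: "K \<ge> 0" "AE y in lebesgue_on {\<alpha><..<\<beta>}. ?k y \<le> K"
  proof -
    have "AE y in lebesgue_on {\<alpha><..<\<beta>}. ?k y \<le> (c1 + B) / (c1 * ess_inf ?I c)"
      using cW
    proof eventually_elim
      case (elim y)
      then have "\<bar>c1 - c y\<bar> \<le> c1 + B" "c1 * ess_inf ?I c \<le> \<bar>c1 * c y\<bar>"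
        using c1 cm by (auto simp: abs_mult)
      then show ?case unfolding abs_divide
        using c1 cm by (intro frac_le) auto
    qed
    moreover have "(\<lambda>y. ?k y) \<in> borel_measurable (lebesgue_on {\<alpha><..<\<beta>})"
      using cmeasW by measurable
    moreover have "emeasure lebesgue {\<alpha><..<\<beta>} \<noteq> 0" using \<alpha>\<beta> by simp
    ultimately show "K \<ge> 0" "AE y in lebesgue_on {\<alpha><..<\<beta>}. ?k y \<le> K"
      unfolding K_def using ess_sup_bounds[of ?k "{\<alpha><..<\<beta>}" 0] by auto
  qed
  then show "K \<ge> 0" by simp
  obtain u' u'' where u': "weak_deriv ?I 1 u u'" "weak_deriv ?I 1 u' u''"
      and u'': "AE y in ?M. lam * u y = c y * (m\<^sup>2 * u y - u'' y)"
    using u by (auto simp: op_Ak_def)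
  have H10: "u \<in> H10 ?I" and uL: "u \<in> L2 ?I" and uc: "integrable ?M (\<lambda>y. (u y)\<^sup>2 / c y)"
    using u by (auto simp: op_Ak_def H2_def H1_def L2w_def)
  obtain g where g: "g \<in> L2 ?I" and ug: "(\<integral>x. u x * g x \<partial>?M) = 0"
    and id: "\<And>\<eta>. smooth \<eta> \<Longrightarrow> (\<integral>x. \<eta> x * ((g x)\<^sup>2 + u'' x * u x)
        + frechet_derivative \<eta> (at x) 1 * (u x * g x) \<partial>?M) = 0"
    using energy_identity_smooth[OF H10 u'] by blast
  have u''u: "AE y in ?M. u'' y * u y = m\<^sup>2 * (u y)\<^sup>2 - lam * ((u y)\<^sup>2 / c y)"
    using u'' cpos
  proof eventually_elim
    case (elim y)
    then have "c y > 0" using cm by linarith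
    then have "u'' y = m\<^sup>2 * u y - lam * u y / c y"
      using elim(1) by (simp add: field_simps)
    then have "u'' y * u y = (m\<^sup>2 * u y - lam * u y / c y) * u y" by simp
    then show ?case by (simp add: power2_eq_square left_diff_distrib)
  qed
  have mu'': "u'' \<in> borel_measurable ?M" using u'(2) by (auto simp: weak_deriv_def L2_iff)
  have ms [measurable]: "u \<in> borel_measurable ?M" "g \<in> borel_measurable ?M" "c \<in> borel_measurable ?M"
      "u'' \<in> borel_measurable ?M"
    using uL g cmeas mu'' by (auto simp: L2_iff)
  show lam: "lam \<ge> 0"
  proof -
    have "0 = (\<integral>x. (g x)\<^sup>2 + u'' x * u x \<partial>?M)"
      using id[of "\<lambda>_. 1"] smooth_real_polynomial_function[OF real_polynomial_function.intros(2)]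
      by (simp add: frechet_derivative_const)
    also have "\<dots> = (\<integral>x. (g x)\<^sup>2 + m\<^sup>2 * (u x)\<^sup>2 - lam * ((u x)\<^sup>2 / c x) \<partial>?M)"
      by (rule integral_cong_AE) (use u''u in \<open>auto elim: eventually_mono\<close>)
    also have "\<dots> = (\<integral>x. (g x)\<^sup>2 \<partial>?M) + m\<^sup>2 * (\<integral>x. (u x)\<^sup>2 \<partial>?M) - lam"
      using uL g uc norm by (simp add: L2_iff del: times_divide_eq_right)
    finally have "lam = (\<integral>x. (g x)\<^sup>2 \<partial>?M) + m\<^sup>2 * (\<integral>x. (u x)\<^sup>2 \<partial>?M)" by simp
    then show ?thesis by simp
  qed
  define q where "q = (\<lambda>y. lam / c y - lam / c1)"
  have qu_eq: "(\<lambda>x. q x * (u x)\<^sup>2) = (\<lambda>x. lam * ((u x)\<^sup>2 / c x) - lam / c1 * (u x)\<^sup>2)"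
    by (auto simp: q_def left_diff_distrib)
  have qu: "integrable ?M (\<lambda>x. q x * (u x)\<^sup>2)"
    unfolding qu_eq using integrable_mult_right[OF uc, of lam]
      integrable_mult_right[OF L2_integrable[OF uL], of "lam / c1"]
    by (intro Bochner_Integration.integrable_diff)
  have id': "(\<integral>x. \<eta> x * ((g x)\<^sup>2 + p\<^sup>2 * (u x)\<^sup>2 - q x * (u x)\<^sup>2)
        + frechet_derivative \<eta> (at x) 1 * (u x * g x) \<partial>?M) = 0" if \<eta>: "smooth \<eta>" for \<eta>
  proof -
    have [measurable]: "\<eta> \<in> borel_measurable ?M" "(\<lambda>x. frechet_derivative \<eta> (at x) 1) \<in> borel_measurable ?M"
      by (intro continuous_measurable_lebesgue_on smooth_continuous_on smooth_frechet_derivative \<eta>)+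
    have [measurable]: "q \<in> borel_measurable ?M" unfolding q_def by measurable
    have "(\<integral>x. \<eta> x * ((g x)\<^sup>2 + p\<^sup>2 * (u x)\<^sup>2 - q x * (u x)\<^sup>2)
        + frechet_derivative \<eta> (at x) 1 * (u x * g x) \<partial>?M) =
      (\<integral>x. \<eta> x * ((g x)\<^sup>2 + u'' x * u x)
        + frechet_derivative \<eta> (at x) 1 * (u x * g x) \<partial>?M)"
    proof (rule integral_cong_AE)
      show "AE x in ?M. \<eta> x * ((g x)\<^sup>2 + p\<^sup>2 * (u x)\<^sup>2 - q x * (u x)\<^sup>2)
          + frechet_derivative \<eta> (at x) 1 * (u x * g x) =
          \<eta> x * ((g x)\<^sup>2 + u'' x * u x) + frechet_derivative \<eta> (at x) 1 * (u x * g x)"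
        using u''u
      proof eventually_elim
        case (elim x)
        have "p\<^sup>2 * (u x)\<^sup>2 - q x * (u x)\<^sup>2 = u'' x * u x"
          unfolding elim p(2) by (simp add: q_def left_diff_distrib)
        then show ?case by (simp add: algebra_simps)
      qed
    qed measurable
    then show ?thesis using id[OF \<eta>] by simp
  qed
  have qle: "AE y in ?M. q y \<le> (if y \<in> {\<alpha><..<\<beta>} then lam * K else 0)"
  proof -
    have "AE y in lebesgue. y \<in> ?I - {\<alpha><..<\<beta>} \<longrightarrow> c1 \<le> c y"
      using well by (simp add: is_well_def AE_restrict_space_iff)
    then have 1: "AE y in ?M. y \<notin> {\<alpha><..<\<beta>} \<longrightarrow> c1 \<le> c y"
      by (simp add: AE_restrict_space_iff) (erule eventually_mono, auto)
    have "AE y in lebesgue. y \<in> {\<alpha><..<\<beta>} \<longrightarrow> ?k y \<le> K"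
      using K(2) by (simp add: AE_restrict_space_iff)
    then have 2: "AE y in ?M. y \<in> {\<alpha><..<\<beta>} \<longrightarrow> ?k y \<le> K"
      by (simp add: AE_restrict_space_iff) (erule eventually_mono, auto)
    show ?thesis using 1 2 cpos
    proof eventually_elim
      case (elim y)
      have cy: "c y > 0" using elim(3) cm by linarith
      have q: "q y = lam * ((c1 - c y) / (c1 * c y))"
        using cy c1 by (simp add: q_def field_simps)
      show ?case
      proof (cases "y \<in> {\<alpha><..<\<beta>}")
        case True
        then have "(c1 - c y) / (c1 * c y) \<le> K" using elim(2) by (auto simp del: abs_divide)
        then have "lam * ((c1 - c y) / (c1 * c y)) \<le> lam * K" using lam by (rule mult_left_mono)
        then show ?thesis unfolding q if_P[OF True] .
      next
        case False
        then have "(c1 - c y) / (c1 * c y) \<le> 0" using elim(1) c1 cy by (simp add: divide_le_0_iff)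
        with lam have "lam * ((c1 - c y) / (c1 * c y)) \<le> 0" by (rule mult_nonneg_nonpos)
        then show ?thesis unfolding q if_not_P[OF False] .
      qed
    qed
  qed
  define A where "A = (\<integral>y. (u y)\<^sup>2 \<partial>lebesgue_on {a<..<b})"
  define W where "W = (\<integral>y. (u y)\<^sup>2 \<partial>lebesgue_on {\<alpha><..<\<beta>})"
  define x where "x = \<xi> * d"
  define N where "N = 2 * exp (2 * p * d) - 1"
  have x: "x > 0" using \<xi> d by (simp add: x_def)
  have est: "p\<^sup>2 * (N - 1 / N) * A \<le> lam * K * W"
    using d(2)
  proof
    assume right: "d = a - \<beta>"
    show ?thesis unfolding N_def A_def W_def
      by (rule decay_from_energy_identity[OF H p(1) _ uL g qu ug id' qle subW subF,
            where l = \<beta> and r = a and z = \<beta> and s = 1])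
         (use right d(1) lam K(1) in \<open>auto simp: abs_if\<close>)
  next
    assume left: "d = \<alpha> - b"
    show ?thesis unfolding N_def A_def W_def
      by (rule decay_from_energy_identity[OF H p(1) _ uL g qu ug id' qle subW subF,
            where l = b and r = \<alpha> and z = \<alpha> and s = "- 1"])
         (use left d(1) lam K(1) in \<open>auto simp: abs_if\<close>)
  qed
  have "2 * p * d = sqrt 2 * x"
    by (simp add: p_def x_def field_simps flip: power2_eq_square)
  then have N: "N = 2 * exp (sqrt 2 * x) - 1" by (simp add: N_def)
  have "N \<ge> 1" unfolding N using x by simp
  then have "1 / N \<le> 1" by simp
  then have "2 * (x * exp x) \<le> N - 1 / N"
    using exp_weight_bound[OF x] unfolding N by linarith
  moreover have A0: "A \<ge> 0" and W0: "W \<ge> 0" by (simp_all add: A_def W_def)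
  ultimately have "p\<^sup>2 * (2 * (x * exp x)) * A \<le> lam * K * W"
    using est by (smt (verit) mult_right_mono mult_left_mono zero_le_power2)
  moreover have "p\<^sup>2 * 2 = \<xi>\<^sup>2" by (simp add: p_def power_divide)
  ultimately have "\<xi>\<^sup>2 * (x * exp x) * A \<le> lam * K * W"
    by (simp add: mult.assoc[symmetric])
  then have "A \<le> lam * K * W / (\<xi>\<^sup>2 * (x * exp x))"
    using x \<xi>(1) by (simp add: field_simps)
  also have "\<dots> = K * (lam / \<xi> ^ 3) * (exp (- x) / d) * W"
    using d(1) \<xi>(1) by (simp add: x_def exp_minus field_simps power2_eq_square power3_eq_cube)
  also have "\<dots> \<le> K * (lam / \<xi> ^ 3) * (exp (- \<xi> * (1 - t) * d) / ((1 - t) * d)) * W"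
  proof -
    have "(1 - t) * x \<le> 1 * x" using t x by (intro mult_right_mono) auto
    then have "exp (- x) \<le> exp (- \<xi> * (1 - t) * d)" by (simp add: x_def algebra_simps)
    moreover have "(1 - t) * d \<le> d" "0 < (1 - t) * d" using t d by (auto simp: mult_le_cancel_right1)
    ultimately have "exp (- x) / d \<le> exp (- \<xi> * (1 - t) * d) / ((1 - t) * d)"
      by (intro frac_le) auto
    moreover have "K * (lam / \<xi> ^ 3) \<ge> 0" using K(1) lam \<xi>(1) by simp
    ultimately show ?thesis using W0 by (intro mult_right_mono mult_left_mono) auto
  qed
  finally show "(\<integral>y. (u y)\<^sup>2 \<partial>lebesgue_on {a<..<b}) \<le>
      K * (lam / \<xi> ^ 3) * (exp (- \<xi> * (1 - t) * d) / ((1 - t) * d))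
        * (\<integral>y. (u y)\<^sup>2 \<partial>lebesgue_on {\<alpha><..<\<beta>})"
    by (simp add: A_def W_def)
qed

section \<open>Distances between layers and the theorem\<close>

lemma closure_layer:
  fixes S :: "'a::euclidean_space set"
  assumes "a < b" shows "closure (layer S a b) = closure S \<times> {a..b}"
  using assms by (simp add: layer_def closure_Times)

lemma setdist_layers:
  fixes S :: "'a::euclidean_space set"
  assumes S: "S \<noteq> {}" and ab: "a < b" and \<alpha>\<beta>: "\<alpha> < \<beta>"
  shows "\<beta> \<le> a \<Longrightarrow> setdist (closure (layer S a b)) (layer S \<alpha> \<beta>) = a - \<beta>"
    and "b \<le> \<alpha> \<Longrightarrow> setdist (closure (layer S a b)) (layer S \<alpha> \<beta>) = \<alpha> - b"
proof -
  obtain x where x: "x \<in> closure S" using S closure_subset by blast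
  have eq: "setdist (closure (layer S a b)) (layer S \<alpha> \<beta>) =
      setdist (closure S \<times> {a..b}) (closure S \<times> {\<alpha>..\<beta>})"
    by (simp add: closure_layer[symmetric] ab \<alpha>\<beta>)
  have ge: "\<delta> \<le> setdist (closure S \<times> {a..b}) (closure S \<times> {\<alpha>..\<beta>})"
    if "\<And>y y'. y \<in> {a..b} \<Longrightarrow> y' \<in> {\<alpha>..\<beta>} \<Longrightarrow> \<delta> \<le> dist y y'" for \<delta>
  proof (rule le_setdistI)
    show "closure S \<times> {a..b} \<noteq> {}" "closure S \<times> {\<alpha>..\<beta>} \<noteq> {}" using S ab \<alpha>\<beta> by auto
    fix z z' :: "'a \<times> real" assume "z \<in> closure S \<times> {a..b}" "z' \<in> closure S \<times> {\<alpha>..\<beta>}"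
    then have "\<delta> \<le> dist (snd z) (snd z')" by (intro that) auto
    also have "\<dots> \<le> dist z z'" by (rule dist_snd_le)
    finally show "\<delta> \<le> dist z z'" .
  qed
  have le: "setdist (closure S \<times> {a..b}) (closure S \<times> {\<alpha>..\<beta>}) \<le> dist y y'"
    if "y \<in> {a..b}" "y' \<in> {\<alpha>..\<beta>}" for y y'
  proof -
    have "setdist (closure S \<times> {a..b}) (closure S \<times> {\<alpha>..\<beta>}) \<le> dist (x, y) (x, y')"
      using that x by (intro setdist_le_dist) auto
    then show ?thesis by (simp add: dist_Pair_Pair)
  qed
  show "setdist (closure (layer S a b)) (layer S \<alpha> \<beta>) = a - \<beta>" if "\<beta> \<le> a"
    unfolding eq using le[of a \<beta>] ab \<alpha>\<beta> that
    by (intro antisym ge) (auto simp: dist_real_def)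
  show "setdist (closure (layer S a b)) (layer S \<alpha> \<beta>) = \<alpha> - b" if "b \<le> \<alpha>"
    unfolding eq using le[of b \<alpha>] ab \<alpha>\<beta> that
    by (intro antisym ge) (auto simp: dist_real_def)
qed

theorem theorem2p4:
  fixes \<Omega>' :: "(real ^ 'n) set" and H :: real and c :: "real \<Rightarrow> real"
    and \<mu> :: "nat \<Rightarrow> real" and \<phi> :: "nat \<Rightarrow> real ^ 'n \<Rightarrow> real"
    and \<alpha> \<beta> c1 a b :: real
  assumes "bounded_smooth_domain \<Omega>'" and "H > 0"
    and "dirichlet_eigensystem \<Omega>' \<mu> \<phi>"
    and "c \<in> Linf {0<..<H}"
    and "0 < ess_inf {0<..<H} c" and "ess_inf {0<..<H} c < ess_sup {0<..<H} c"
    and "0 \<le> \<alpha>" and "\<alpha> < \<beta>" and "\<beta> \<le> H"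
    and "is_well H c \<alpha> \<beta> c1"
    and "0 \<le> a" and "a < b" and "b \<le> H"
    and "closure (layer \<Omega>' a b) \<subseteq> closure (layer \<Omega>' 0 H) - closure (layer \<Omega>' \<alpha> \<beta>)"
  shows "(\<forall>k\<ge>1. \<forall>lam u.
            eigenfunction {0<..<H} (op_Ak H c (\<mu> k)) lam u \<and>
            (\<integral>y. (u y)\<^sup>2 / c y \<partial>lebesgue_on {0<..<H}) = 1 \<longrightarrow>
            eigenfunction (layer \<Omega>' 0 H) (op_A (layer \<Omega>' 0 H) (\<lambda>x. c (snd x))) lam (tensor (\<phi> k) u) \<and>
            (\<forall>\<xi>>0. \<forall>d t. \<xi>\<^sup>2 = 2 * ((\<mu> k)\<^sup>2 - lam / c1) \<and>
               d = setdist (closure (layer \<Omega>' a b)) (layer \<Omega>' \<alpha> \<beta>) \<and> 0 < t \<and> t < 1 \<longrightarrow>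
               (\<integral>x. (tensor (\<phi> k) u x)\<^sup>2 \<partial>lebesgue_on (layer \<Omega>' a b))
               \<le> ess_sup {\<alpha><..<\<beta>} (\<lambda>y. \<bar>(c1 - c y) / (c1 * c y)\<bar>) * (lam / \<xi> ^ 3)
                 * (exp (- \<xi> * (1 - t) * d) / ((1 - t) * d))
                 * (\<integral>x. (tensor (\<phi> k) u x)\<^sup>2 \<partial>lebesgue_on (layer \<Omega>' \<alpha> \<beta>))))
       \<and> (\<forall>\<epsilon>>0. \<forall>w :: nat \<Rightarrow> real \<Rightarrow> real \<Rightarrow> real.
            (\<forall>(k, lam)\<in>guided_pairs H c \<mu> c1 \<epsilon>.
               eigenfunction {0<..<H} (op_Ak H c (\<mu> k)) lam (w k lam) \<and>
               (\<integral>x. \<bar>tensor (\<phi> k) (w k lam) x\<bar>\<^sup>2 / c (snd x) \<partial>lebesgue_on (layer \<Omega>' 0 H)) = 1) \<longrightarrow>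
            ((\<lambda>(k, lam). \<integral>x. \<bar>tensor (\<phi> k) (w k lam) x\<bar>\<^sup>2 \<partial>lebesgue_on (layer \<Omega>' a b)) \<longlongrightarrow> 0)
              (inf (filtercomap snd at_top) (principal (guided_pairs H c \<mu> c1 \<epsilon>))))"
proof -
  note H = \<open>H > 0\<close> and c = \<open>c \<in> Linf {0<..<H}\<close> and cm = \<open>0 < ess_inf {0<..<H} c\<close>
    and \<alpha>\<beta> = \<open>0 \<le> \<alpha>\<close> \<open>\<alpha> < \<beta>\<close> \<open>\<beta> \<le> H\<close> and well = \<open>is_well H c \<alpha> \<beta> c1\<close>
    and ab = \<open>0 \<le> a\<close> \<open>a < b\<close> \<open>b \<le> H\<close>
  let ?K = "ess_sup {\<alpha><..<\<beta>} (\<lambda>y. \<bar>(c1 - c y) / (c1 * c y)\<bar>)"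
  let ?I = "{0<..<H}"
  define d where "d = setdist (closure (layer \<Omega>' a b)) (layer \<Omega>' \<alpha> \<beta>)"
  have \<Omega>: "\<Omega>' \<in> sets lebesgue" "\<Omega>' \<noteq> {}"
    using assms(1) by (auto simp: bounded_smooth_domain_def)
  have \<phi>: "eigenfunction \<Omega>' (op_A \<Omega>' (\<lambda>_. 1)) ((\<mu> k)\<^sup>2) (\<phi> k)"
      "(\<integral>x. \<phi> k x * \<phi> k x \<partial>lebesgue_on \<Omega>') = 1" if "k \<ge> 1" for k
    using assms(3) that by (auto simp: dirichlet_eigensystem_def)
  have \<phi>L: "\<phi> k \<in> L2 \<Omega>'" if "k \<ge> 1" for k
    using \<phi>(1)[OF that] by (auto simp: eigenfunction_def op_A_def H2_def H1_def)
  have uL: "u \<in> L2 ?I" if "eigenfunction ?I (op_Ak H c m) lam u" for m lam u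
    using that by (auto simp: eigenfunction_def op_Ak_def H2_def H1_def)
  have sub: "{\<alpha><..<\<beta>} \<subseteq> ?I" "{a<..<b} \<subseteq> ?I" using \<alpha>\<beta> ab by auto
  have c1: "c1 > 0" using well cm by (simp add: is_well_def)
  have d: "d > 0" "d = a - \<beta> \<or> d = \<alpha> - b"
  proof -
    obtain x where x: "x \<in> closure \<Omega>'" using \<Omega>(2) closure_subset by blast
    have "y \<notin> {\<alpha>..\<beta>}" if "y \<in> {a..b}" for y
    proof -
      have "(x, y) \<in> closure (layer \<Omega>' a b)" using x that by (simp add: closure_layer ab)
      then have "(x, y) \<notin> closure (layer \<Omega>' \<alpha> \<beta>)" using assms(14) by blast
      then show ?thesis using x by (simp add: closure_layer \<alpha>\<beta>)
    qed
    from this[of a] this[of b] this[of \<alpha>] have "\<beta> < a \<or> b < \<alpha>" using ab \<alpha>\<beta> by auto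
    then show "d > 0" "d = a - \<beta> \<or> d = \<alpha> - b"
      using setdist_layers[OF \<Omega>(2) ab(2) \<alpha>\<beta>(2)] by (auto simp: d_def)
  qed
  have eig: "eigenfunction (layer \<Omega>' 0 H) (op_A (layer \<Omega>' 0 H) (\<lambda>x. c (snd x))) lam (tensor (\<phi> k) u)"
    if "k \<ge> 1" "eigenfunction ?I (op_Ak H c (\<mu> k)) lam u" for k lam u
    using eigenfunction_tensor[OF \<Omega>(1) \<phi>[OF that(1)] that(2)] by (simp add: layer_def)
  have est: "lam \<ge> 0" "?K \<ge> 0"
      "(\<integral>x. (tensor (\<phi> k) u x)\<^sup>2 \<partial>lebesgue_on (layer \<Omega>' a b))
        \<le> ?K * (lam / \<xi> ^ 3) * (exp (- \<xi> * (1 - t) * d) / ((1 - t) * d))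
          * (\<integral>x. (tensor (\<phi> k) u x)\<^sup>2 \<partial>lebesgue_on (layer \<Omega>' \<alpha> \<beta>))"
    if k: "k \<ge> 1" and u: "eigenfunction ?I (op_Ak H c (\<mu> k)) lam u"
      and norm: "(\<integral>y. (u y)\<^sup>2 / c y \<partial>lebesgue_on ?I) = 1"
      and \<xi>: "\<xi> > 0" "\<xi>\<^sup>2 = 2 * ((\<mu> k)\<^sup>2 - lam / c1)" and t: "0 < t" "t < 1" for k lam u \<xi> t
  proof -
    have "(u, \<lambda>y. lam * u y) \<in> op_Ak H c (\<mu> k)" using u by (simp add: eigenfunction_def)
    from well_decay[OF H c cm \<alpha>\<beta> ab well this norm \<xi> d t]
    show "lam \<ge> 0" "?K \<ge> 0"
      "(\<integral>x. (tensor (\<phi> k) u x)\<^sup>2 \<partial>lebesgue_on (layer \<Omega>' a b))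
        \<le> ?K * (lam / \<xi> ^ 3) * (exp (- \<xi> * (1 - t) * d) / ((1 - t) * d))
          * (\<integral>x. (tensor (\<phi> k) u x)\<^sup>2 \<partial>lebesgue_on (layer \<Omega>' \<alpha> \<beta>))"
      unfolding layer_integral_tensor_square[OF \<Omega>(1) \<phi>L[OF k] \<phi>(2)[OF k] uL[OF u] sub(1)]
        layer_integral_tensor_square[OF \<Omega>(1) \<phi>L[OF k] \<phi>(2)[OF k] uL[OF u] sub(2)] by auto
  qed
  have "((\<lambda>(k, lam). \<integral>x. \<bar>tensor (\<phi> k) (w k lam) x\<bar>\<^sup>2 \<partial>lebesgue_on (layer \<Omega>' a b)) \<longlongrightarrow> 0)
      (inf (filtercomap snd at_top) (principal (guided_pairs H c \<mu> c1 \<epsilon>)))" (is "(?f \<longlongrightarrow> 0) ?F")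
    if \<epsilon>: "\<epsilon> > 0" and w: "\<forall>(k, lam)\<in>guided_pairs H c \<mu> c1 \<epsilon>.
      eigenfunction ?I (op_Ak H c (\<mu> k)) lam (w k lam) \<and>
      (\<integral>x. \<bar>tensor (\<phi> k) (w k lam) x\<bar>\<^sup>2 / c (snd x) \<partial>lebesgue_on (layer \<Omega>' 0 H)) = 1" for \<epsilon> w
  proof -
    obtain B where B: "AE y in lebesgue_on ?I. \<bar>c y\<bar> \<le> B" using Linf_bounded[OF c] by blast
    have cpos: "AE y in lebesgue_on ?I. ess_inf ?I c \<le> c y"
      by (rule ess_inf_le[OF c]) (use H in auto)
    \<comment> \<open>\<open>\<delta>\<close> is the constant in \<open>\<xi>\<^sup>2 \<ge> \<delta> lam\<close>; \<open>C\<close> collects the estimate at \<open>t = 1/2\<close>,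
      with the exponential bounded by \<open>1\<close> and \<open>\<integral> v\<^sup>2 \<le> B \<integral> v\<^sup>2 / c = B\<close>\<close>
    define \<delta> where "\<delta> = 2 * (1 / (c1 - \<epsilon>) - 1 / c1)"
    define C where "C = ?K * (2 / (\<delta> * sqrt \<delta> * d)) * B"
    have bound: "0 \<le> ?f z \<and> ?f z \<le> C / sqrt (snd z)"
      if z: "z \<in> guided_pairs H c \<mu> c1 \<epsilon>" and pos: "snd z > 0" for z
    proof -
      obtain k lam where zk: "z = (k, lam)" by (cases z)
      let ?u = "w k lam"
      have k: "k \<ge> 1" and le: "lam \<le> (c1 - \<epsilon>) * (\<mu> k)\<^sup>2" and lam: "lam > 0"
        using z pos by (auto simp: zk guided_pairs_def)
      have u: "eigenfunction ?I (op_Ak H c (\<mu> k)) lam ?u"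
        and n: "(\<integral>x. \<bar>tensor (\<phi> k) ?u x\<bar>\<^sup>2 / c (snd x) \<partial>lebesgue_on (layer \<Omega>' 0 H)) = 1"
        using w z by (auto simp: zk)
      interpret real_lebesgue_product \<Omega>' ?I
        by (intro real_lebesgue_product.intro lebesgue_product.intro \<Omega>) simp
      have uc: "integrable (lebesgue_on ?I) (\<lambda>y. (?u y)\<^sup>2 / c y)"
        using u by (auto simp: eigenfunction_def op_Ak_def L2w_def)
      have norm: "(\<integral>y. (?u y)\<^sup>2 / c y \<partial>lebesgue_on ?I) = 1"
      proof -
        have "(\<integral>x. \<bar>tensor (\<phi> k) ?u x\<bar>\<^sup>2 / c (snd x) \<partial>lebesgue_on (layer \<Omega>' 0 H)) =
            (\<integral>z. tensor (\<lambda>x. (\<phi> k x)\<^sup>2) (\<lambda>y. (?u y)\<^sup>2 / c y) z \<partial>lebesgue_on (\<Omega>' \<times> ?I))"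
          by (simp add: tensor_apply layer_def power_mult_distrib)
        also have "\<dots> = (\<integral>y. (?u y)\<^sup>2 / c y \<partial>lebesgue_on ?I)"
          unfolding integral_tensor(2)[OF L2_integrable[OF \<phi>L[OF k]] uc]
          using \<phi>(2)[OF k] by (simp add: power2_eq_square)
        finally show ?thesis using n by simp
      qed
      have \<epsilon>c: "c1 - \<epsilon> > 0"
        using le lam by (smt (verit) mult_nonneg_nonneg mult_nonpos_nonneg zero_le_power2)
      then have \<delta>: "\<delta> > 0" using \<epsilon> c1 by (simp add: \<delta>_def field_simps)
      define \<xi> where "\<xi> = sqrt (2 * ((\<mu> k)\<^sup>2 - lam / c1))"
      have "\<delta> * lam = 2 * (lam / (c1 - \<epsilon>) - lam / c1)"
        by (simp add: \<delta>_def left_diff_distrib)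
      moreover have "lam / (c1 - \<epsilon>) \<le> (\<mu> k)\<^sup>2" using le \<epsilon>c by (simp add: divide_le_eq mult.commute)
      ultimately have \<xi>2: "\<delta> * lam \<le> 2 * ((\<mu> k)\<^sup>2 - lam / c1)"
        by (simp only: mult_le_cancel_left_pos zero_less_numeral diff_right_mono)
      define s where "s = sqrt (\<delta> * lam)"
      have s: "s > 0" "s \<le> \<xi>" using \<xi>2 \<delta> lam by (auto simp: s_def \<xi>_def)
      have \<xi>: "\<xi> > 0" "\<xi>\<^sup>2 = 2 * ((\<mu> k)\<^sup>2 - lam / c1)"
      proof -
        have "0 \<le> 2 * ((\<mu> k)\<^sup>2 - lam / c1)"
          using \<xi>2 mult_pos_pos[OF \<delta> lam] by linarith
        then show "\<xi>\<^sup>2 = 2 * ((\<mu> k)\<^sup>2 - lam / c1)" by (simp only: \<xi>_def real_sqrt_pow2)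
        show "\<xi> > 0" using s by linarith
      qed
      let ?W = "\<integral>x. (tensor (\<phi> k) ?u x)\<^sup>2 \<partial>lebesgue_on (layer \<Omega>' \<alpha> \<beta>)"
      have "?W = (\<integral>y. (?u y)\<^sup>2 \<partial>lebesgue_on {\<alpha><..<\<beta>})"
        by (rule layer_integral_tensor_square[OF \<Omega>(1) \<phi>L[OF k] \<phi>(2)[OF k] uL[OF u] sub(1)])
      also have "\<dots> \<le> (\<integral>y. B * ((?u y)\<^sup>2 / c y) \<partial>lebesgue_on ?I)"
      proof (rule integral_subset_mono[OF sub(1)])
        show "integrable (lebesgue_on {\<alpha><..<\<beta>}) (\<lambda>y. (?u y)\<^sup>2)"
          by (rule L2_integrable[OF L2_subset[OF uL[OF u] sub(1)]]) simp_all
        show "AE y in lebesgue_on ?I. (?u y)\<^sup>2 \<le> B * ((?u y)\<^sup>2 / c y)"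
          using cpos B
        proof eventually_elim
          case (elim y)
          then have "c y > 0" "c y \<le> B" using cm by auto
          then show ?case by (simp add: pos_le_divide_eq mult_right_mono mult.commute)
        qed
        show "AE y in lebesgue_on ?I. 0 \<le> B * ((?u y)\<^sup>2 / c y)"
          using cpos B by eventually_elim (use cm in auto)
      qed (use integrable_mult_right[OF uc, of B] in auto)
      finally have W: "?W \<le> B" by (simp only: integral_mult_right_zero norm mult_1_right)
      have lamx: "lam / \<xi> ^ 3 \<le> lam / s ^ 3"
        using s lam by (intro divide_left_mono power_mono) auto
      have "s ^ 3 = \<delta> * sqrt \<delta> * (lam * sqrt lam)"
      proof -
        have "s\<^sup>2 = \<delta> * lam" using \<delta> lam by (simp add: s_def)
        moreover have "s ^ 3 = s\<^sup>2 * s" by (simp add: power3_eq_cube power2_eq_square)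
        moreover have "s = sqrt \<delta> * sqrt lam" by (simp add: s_def real_sqrt_mult)
        ultimately show ?thesis by (simp only: mult_ac)
      qed
      then have lams: "lam / s ^ 3 = 1 / (\<delta> * sqrt \<delta>) / sqrt lam" using lam by simp
      have e: "exp (- \<xi> * (1 - 1 / 2) * d) / ((1 - 1 / 2) * d) \<le> 2 / d"
        using \<xi>(1) d(1) by (simp add: field_simps)
      have K: "?K \<ge> 0" by (rule est(2)[OF k u norm \<xi>, of "1 / 2"]) auto
      have "?f z \<le> ?K * (lam / \<xi> ^ 3) * (exp (- \<xi> * (1 - 1 / 2) * d) / ((1 - 1 / 2) * d)) * ?W"
        using est(3)[OF k u norm \<xi>, of "1 / 2"] by (simp add: zk)
      also have "\<dots> \<le> ?K * (lam / s ^ 3) * (2 / d) * B"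
        using K lam s d(1) \<xi>(1) by (intro mult_mono lamx e W mult_left_mono) auto
      also have "\<dots> = C / sqrt (snd z)" by (simp add: C_def lams zk)
      finally show ?thesis by (simp add: zk)
    qed
    have "filterlim snd at_top ?F"
      by (rule filterlim_mono[OF filterlim_filtercomap order_refl]) simp
    then have top: "filterlim (\<lambda>z. sqrt (snd z)) at_top ?F" and pos: "\<forall>\<^sub>F z in ?F. snd z > 0"
      using filterlim_compose[OF sqrt_at_top] by (auto simp: filterlim_at_top_dense)
    have lim: "((\<lambda>z. C / sqrt (snd z)) \<longlongrightarrow> 0) ?F"
      by (rule tendsto_divide_0[OF tendsto_const]) (rule filterlim_at_top_imp_at_infinity[OF top])
    have "\<forall>\<^sub>F z in ?F. z \<in> guided_pairs H c \<mu> c1 \<epsilon>"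
      by (simp add: eventually_inf_principal)
    with pos have ev: "\<forall>\<^sub>F z in ?F. 0 \<le> ?f z \<and> ?f z \<le> C / sqrt (snd z)"
      by eventually_elim (rule bound)
    show ?thesis
      by (rule tendsto_sandwich[OF _ _ tendsto_const lim])
         (use ev in \<open>auto elim: eventually_mono\<close>)
  qed
  then show ?thesis
    using eig est(3) by (auto simp: d_def)
qed

end
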